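(* Let $\mathcal{C}$ be the additive code over $\mathrm{GF}(4)$ of length 24 generated by all cyclic shifts of the vector $$(\omega,0,1,1,0,1,1,1,1,1,1,1,1,1,1,0,1,0,0,0,0,1,1,0).$$ Then $\mathcal{C}$ is an isodual $(24,2^{24},9)$ code, its automorphism group has order $72$, and its weight enumerator is $$\begin{aligned}W_{24}(1,y)={}&1+1752y^9+8748y^{10}+26064y^{11}+81408y^{12}+232776y^{13}+573516y^{14}\\&+1119264y^{15}+1869777y^{16}+2676456y^{17}+3096804y^{18}+2959056y^{19}\\&+2204568y^{20}+1255416y^{21}+520740y^{22}+134208y^{23}+16662y^{24}.\end{aligned}$$
   Context: $\mathrm{GF}(4)=\{0,1,\omega,\omega^2\}$ with $\omega^2=\omega+1$; conjugation is $\overline{x}=x^2$ and $\mathrm{Tr}(x)=x+\overline{x}$. An additive $(n,2^k,d)$ code over $\mathrm{GF}(4)$ is an additive subgroup of $\mathrm{GF}(4)^n$ with $2^k$ elements and minimum nonzero Hamming weight $d$; "generated" means spanned additively (over $\mathrm{GF}(2)$). The weight enumerator is $W_{\mathcal{C}}(x,y)=\sum_{i=0}^n A_i x^{n-i}y^i$, with $A_i$ the number of codewords of Hamming weight $i$. The dual is $\mathcal{C}^\perp=\{\boldsymbol{u}\in\mathrm{GF}(4)^n \mid \sum_i\mathrm{Tr}(u_i\overline{c_i})=0 \text{ for all } \boldsymbol{c}\in\mathcal{C}\}$. Consider the $6^n n!$ maps of $\mathrm{GF}(4)^n$ consisting of a permutation of coordinates, followed by multiplication of individual coordinates by nonzero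 elements of $\mathrm{GF}(4)$, followed by conjugation of some of the coordinates. Two codes are equivalent if such a map sends one onto the other; the automorphism group of a code consists of all such maps sending the code onto itself. A code is isodual if it is equivalent to its dual. *)

theory Defs
  imports
    "HOL-Analysis.Cartesian_Space"
    "HOL-Library.Numeral_Type"
    "HOL-Computational_Algebra.Group_Closure"
    "HOL-Computational_Algebra.Polynomial"
begin

subsection \<open>The field GF(4)\<close>

datatype gf4 = GF0 | GF1 | GFw | GFw2

lemma UNIV_gf4: "(UNIV :: gf4 set) = {GF0, GF1, GFw, GFw2}"
  using gf4.exhaust by auto

instance gf4 :: finite
  by standard (simp add: UNIV_gf4)

instantiation gf4 :: field
begin

definition zero_gf4 :: gf4 where "zero_gf4 = GF0"

definition one_gf4 :: gf4 where "one_gf4 = GF1"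

fun plus_gf4 :: "gf4 \<Rightarrow> gf4 \<Rightarrow> gf4" where
  "plus_gf4 GF0 y = y"
| "plus_gf4 x GF0 = x"
| "plus_gf4 GF1 GF1 = GF0"
| "plus_gf4 GF1 GFw = GFw2"
| "plus_gf4 GF1 GFw2 = GFw"
| "plus_gf4 GFw GF1 = GFw2"
| "plus_gf4 GFw GFw = GF0"
| "plus_gf4 GFw GFw2 = GF1"
| "plus_gf4 GFw2 GF1 = GFw"
| "plus_gf4 GFw2 GFw = GF1"
| "plus_gf4 GFw2 GFw2 = GF0"

definition uminus_gf4 :: "gf4 \<Rightarrow> gf4" where "uminus_gf4 x = x"

definition minus_gf4 :: "gf4 \<Rightarrow> gf4 \<Rightarrow> gf4" where "minus_gf4 x y = x + y"

fun times_gf4 :: "gf4 \<Rightarrow> gf4 \<Rightarrow> gf4" where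
  "times_gf4 GF0 y = GF0"
| "times_gf4 x GF0 = GF0"
| "times_gf4 GF1 y = y"
| "times_gf4 x GF1 = x"
| "times_gf4 GFw GFw = GFw2"
| "times_gf4 GFw GFw2 = GF1"
| "times_gf4 GFw2 GFw = GF1"
| "times_gf4 GFw2 GFw2 = GFw"

fun inverse_gf4 :: "gf4 \<Rightarrow> gf4" where
  "inverse_gf4 GF0 = GF0"
| "inverse_gf4 GF1 = GF1"
| "inverse_gf4 GFw = GFw2"
| "inverse_gf4 GFw2 = GFw"

definition divide_gf4 :: "gf4 \<Rightarrow> gf4 \<Rightarrow> gf4" where "divide_gf4 x y = x * inverse y"

instance
proof
  fix a b c :: gf4
  show "a * b * c = a * (b * c)" by (cases a; cases b; cases c; simp)
  show "a * b = b * a" by (cases a; cases b; simp)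
  show "1 * a = a" by (cases a; simp add: one_gf4_def)
  show "a + b + c = a + (b + c)" by (cases a; cases b; cases c; simp)
  show "a + b = b + a" by (cases a; cases b; simp)
  show "0 + a = a" by (simp add: zero_gf4_def)
  show "- a + a = 0" by (cases a; simp add: zero_gf4_def uminus_gf4_def)
  show "a - b = a + - b" by (simp add: minus_gf4_def uminus_gf4_def)
  show "(a + b) * c = a * c + b * c" by (cases a; cases b; cases c; simp)
  show "(0 :: gf4) \<noteq> 1" by (simp add: zero_gf4_def one_gf4_def)
  show "a \<noteq> 0 \<Longrightarrow> inverse a * a = 1" by (cases a; simp add: zero_gf4_def one_gf4_def)
  show "a div b = a * inverse b" by (simp add: divide_gf4_def)
  show "inverse (0 :: gf4) = 0" by (simp add: zero_gf4_def)
qed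

end

abbreviation omega :: gf4  ("\<omega>") where "\<omega> \<equiv> GFw"

lemma gf4_elements: "(UNIV :: gf4 set) = {0, 1, \<omega>, \<omega>^2}" "card (UNIV :: gf4 set) = 4"
  and omega_square: "\<omega>^2 = \<omega> + 1"
  by (auto simp: UNIV_gf4 zero_gf4_def one_gf4_def power2_eq_square)

definition conj_gf4 :: "gf4 \<Rightarrow> gf4" where
  "conj_gf4 x = x^2"

definition trace_gf4 :: "gf4 \<Rightarrow> gf4" where
  "trace_gf4 x = x + conj_gf4 x"


subsection \<open>Additive codes over GF(4)\<close>

definition hamming_weight :: "gf4 ^ 'n \<Rightarrow> nat" where
  "hamming_weight v = card {i. v $ i \<noteq> 0}"

text \<open>The minimum is meaningful only for codes with a nonzero codeword.\<close>

definition min_weight :: "(gf4 ^ 'n) set \<Rightarrow> nat" where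
  "min_weight C = Min (hamming_weight ` (C - {0}))"

definition additive_subgroup :: "(gf4 ^ 'n) set \<Rightarrow> bool" where
  "additive_subgroup C \<longleftrightarrow>
     0 \<in> C \<and> (\<forall>u\<in>C. \<forall>v\<in>C. u + v \<in> C) \<and> (\<forall>u\<in>C. - u \<in> C)"

text \<open>\<open>additive_code n k d C\<close>: \<open>C\<close> is an additive \<open>(n, 2\<^sup>k, d)\<close> code.\<close>

definition additive_code :: "nat \<Rightarrow> nat \<Rightarrow> nat \<Rightarrow> (gf4 ^ 'n) set \<Rightarrow> bool" where
  "additive_code n k d C \<longleftrightarrow>
     CARD('n) = n \<and> additive_subgroup C \<and> card C = 2 ^ k \<and>
     C \<noteq> {0} \<and> min_weight C = d"

definition weight_count :: "(gf4 ^ 'n) set \<Rightarrow> nat \<Rightarrow> nat" where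
  "weight_count C i = card {c \<in> C. hamming_weight c = i}"

text \<open>\<open>x\<close> and \<open>y\<close> range over an arbitrary commutative semiring, so they may be
  instantiated with indeterminates of a polynomial ring.\<close>

definition weight_enumerator ::
    "(gf4 ^ 'n) set \<Rightarrow> 'a::comm_semiring_1 \<Rightarrow> 'a \<Rightarrow> 'a" where
  "weight_enumerator C x y =
     (\<Sum>i\<le>CARD('n). of_nat (weight_count C i) * x ^ (CARD('n) - i) * y ^ i)"

definition dual_code :: "(gf4 ^ 'n) set \<Rightarrow> (gf4 ^ 'n) set" where
  "dual_code C = {u. \<forall>c\<in>C. (\<Sum>i\<in>UNIV. trace_gf4 (u $ i * conj_gf4 (c $ i))) = 0}"


subsection \<open>Equivalence and automorphisms\<close>

text \<open>Permute the coordinates by \<open>p\<close>, then scale coordinate \<open>i\<close> by \<open>a i\<close>, then conjugate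
  the coordinates in \<open>S\<close>.\<close>

definition coord_map ::
    "('n \<Rightarrow> 'n) \<Rightarrow> ('n \<Rightarrow> gf4) \<Rightarrow> 'n set \<Rightarrow> gf4 ^ 'n \<Rightarrow> gf4 ^ 'n" where
  "coord_map p a S v =
     (\<chi> i. if i \<in> S then conj_gf4 (a i * v $ p i) else a i * v $ p i)"

definition equivalence_maps :: "(gf4 ^ 'n \<Rightarrow> gf4 ^ 'n) set" where
  "equivalence_maps = {coord_map p a S | p a S. bij p \<and> (\<forall>i. a i \<noteq> 0)}"

definition equivalent_codes :: "(gf4 ^ 'n) set \<Rightarrow> (gf4 ^ 'n) set \<Rightarrow> bool" where
  "equivalent_codes C D \<longleftrightarrow> (\<exists>f\<in>equivalence_maps. f ` C = D)"

definition automorphism_group :: "(gf4 ^ 'n) set \<Rightarrow> (gf4 ^ 'n \<Rightarrow> gf4 ^ 'n) set" where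
  "automorphism_group C = {f \<in> equivalence_maps. f ` C = C}"

definition isodual :: "(gf4 ^ 'n) set \<Rightarrow> bool" where
  "isodual C \<longleftrightarrow> equivalent_codes C (dual_code C)"


subsection \<open>Circulant codes\<close>

text \<open>The index type is a ring of residues such as \<open>24\<close>, where \<open>+\<close> and \<open>-\<close> are modulo
  the length.\<close>

definition cyclic_shift ::
    "'n \<Rightarrow> gf4 ^ ('n::{finite, comm_ring_1}) \<Rightarrow> gf4 ^ ('n::{finite, comm_ring_1})" where
  "cyclic_shift k v = (\<chi> i. v $ (i - k))"

definition circulant_code ::
    "gf4 ^ ('n::{finite, comm_ring_1}) \<Rightarrow> (gf4 ^ ('n::{finite, comm_ring_1})) set" where
  "circulant_code v = group_closure (range (\<lambda>k. cyclic_shift k v))"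

text \<open>\<open>vector\<close> stores the entries at the indices \<open>1, \<dots>, 24\<close>, with \<open>24 = 0\<close> in type \<open>24\<close>.\<close>

definition gen24 :: "gf4 ^ 24" where
  "gen24 = vector
     [\<omega>, 0, 1, 1, 0, 1, 1, 1, 1, 1, 1, 1,
      1, 1, 1, 0, 1, 0, 0, 0, 0, 1, 1, 0]"

definition code24 :: "(gf4 ^ 24) set" where
  "code24 = circulant_code gen24"

end

(* Multiplying even coordinates by omega and odd ones by omega^2 preserves the code, so with respect to
   the splitting into even and odd coordinates it is, up to conjugation, a GF(4)-linear double circulant
   code: the even half determines the odd half. The reversal i -> -i maps every circulant code into its
   dual, whence isoduality. Words of weight at most 12 have at most 6 nonzero entries in one of the halves,
   and the shift by 1 exchanges the halves, so A_0, ..., A_12 follow from an enumeration of words of weight at most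
   6 in GF(4)^12; the power moments of MacWilliams then determine A_13, ..., A_24.

   Every automorphism permutes the 72 vectors of weight 1, and shifts combined with the multiplications above
   act transitively on them. The numbers of words of weight 9 with prescribed entries in two coordinates
   show that an automorphism fixing one such vector is trivial. *)

theory Submission
  imports Defs
begin

text \<open>That the even half determines the odd half is read off a conjectured systematic form,
  given by \<open>check_row\<close>, and two bounds show that this form describes the whole code.
  The 24 generators satisfy it, so the code has at most 4^12 words. Among the entries 0, 1, omega of
  the generator only omega, which occurs once, has nonzero trace; so the coordinatewise traces of
  the shifts are the unit vectors of GF(2)^24, and there are at least 2^24 words.

  The bound 12 in the enumeration is forced by the moments: as the code and its dual have equal
  weight distributions, the moment of order t involves A_i for i <= t on one side and for i <= 24 -
  t on the other. With A_0, ..., A_12 known, t = 11, 10, ..., 0 yields one new number each time.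

  For the automorphisms, a word has entry y at j exactly if adding the vector with single entry y at
  j lowers its weight. Hence the number of words of weight 9 through two vectors of weight 1 is
  invariant. It is 34 for the entries 1 at i and y at j only if y = 1 and j = i + 1 or j = i - 1, so
  an automorphism that fixes one such vector acts on a cycle of length 24.\<close>

lemmas gf4_eval = zero_gf4_def one_gf4_def uminus_gf4_def minus_gf4_def power2_eq_square
  conj_gf4_def trace_gf4_def

lemma gf4_add_self [simp]: "x + x = (0::gf4)"
  by (cases x) (simp_all add: gf4_eval)

lemma gf4_minus [simp]: "- x = (x::gf4)" "x - y = x + (y::gf4)"
  by (simp_all add: gf4_eval)

lemma conj_gf4_simps [simp]:
  "conj_gf4 GF0 = GF0" "conj_gf4 GF1 = GF1" "conj_gf4 GFw = GFw2" "conj_gf4 GFw2 = GFw"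
  by (simp_all add: gf4_eval)

lemma conj_gf4_0 [simp]: "conj_gf4 0 = 0"
  by (simp add: zero_gf4_def)

lemma conj_gf4_add: "conj_gf4 (x + y) = conj_gf4 x + conj_gf4 y"
  by (cases x; cases y) (simp_all add: gf4_eval)

lemma conj_gf4_mult: "conj_gf4 (x * y) = conj_gf4 x * conj_gf4 y"
  by (simp add: conj_gf4_def power_mult_distrib)

lemma conj_gf4_conj [simp]: "conj_gf4 (conj_gf4 x) = x"
  by (cases x) simp_all

lemma conj_gf4_eq_0_iff [simp]: "conj_gf4 x = 0 \<longleftrightarrow> x = 0"
  by (simp add: conj_gf4_def)

lemma trace_gf4_add: "trace_gf4 (x + y) = trace_gf4 x + trace_gf4 y"
  by (simp add: trace_gf4_def conj_gf4_add)

lemma trace_gf4_0 [simp]: "trace_gf4 0 = 0"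
  by (simp add: trace_gf4_def)

lemma vec_add_self [simp]: "v + v = (0 :: gf4 ^ 'n)"
  by (simp only: vec_eq_iff vector_add_component zero_index gf4_add_self simp_thms)

lemma vec_minus [simp]: "- v = (v :: gf4 ^ 'n)" "u - v = u + (v :: gf4 ^ 'n)"
  by (simp_all add: vec_eq_iff)

lemma vec_add_self_left [simp]: "v + (v + w) = (w :: gf4 ^ 'n)"
  by (simp add: add.assoc [symmetric])


subsection \<open>Coordinates as lists\<close>

text \<open>The numeral type \<open>24\<close> is an instance of \<open>bit0\<close>, whose
  representation function returns the residue.\<close>

lemma of_nat_24_eq_iff: "(of_nat m :: 24) = of_nat n \<longleftrightarrow> m mod 24 = n mod 24"
proof -
  have Rep: "Rep_bit0 (of_nat k :: 24) = int (k mod 24)" for k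
    unfolding bit0.of_nat_eq by (subst bit0.Abs_inverse) (simp_all add: zmod_int)
  show ?thesis
    using Rep [of m] Rep [of n] by (metis Rep_bit0_inject of_nat_eq_iff)
qed

lemma ex_of_nat_24: "\<exists>n<24. (i :: 24) = of_nat n"
proof (cases i)
  case (of_int z)
  then show ?thesis
    by (intro exI [of _ "nat z"]) simp_all
qed

lemma range_of_nat_24: "(of_nat :: nat \<Rightarrow> 24) ` {..<24} = UNIV"
  using ex_of_nat_24 by (auto simp: image_iff)

lemma inj_on_of_nat_24: "inj_on (of_nat :: nat \<Rightarrow> 24) {..<24}"
  by (auto simp: inj_on_def of_nat_24_eq_iff)

lemma sum_UNIV_24: "(\<Sum>i\<in>UNIV. f (i :: 24)) = (\<Sum>n<24. f (of_nat n))"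
  by (subst range_of_nat_24 [symmetric]) (simp add: sum.reindex inj_on_of_nat_24)

text \<open>Since the displayed entries occupy the indices 1 to 24 and 24 = 0, the first of them
  opens the odd half and the last one opens the even half. Lists allow structural recursion over a
  half.\<close>

definition evens :: "gf4 ^ 24 \<Rightarrow> gf4 list" where
  "evens v = map (\<lambda>k. v $ of_nat (2 * k)) [0..<12]"

definition odds :: "gf4 ^ 24 \<Rightarrow> gf4 list" where
  "odds v = map (\<lambda>k. v $ of_nat (2 * k + 1)) [0..<12]"

definition list_weight :: "gf4 list \<Rightarrow> nat" where
  "list_weight xs = length (filter (\<lambda>x. x \<noteq> 0) xs)"

lemma length_evens [simp]: "length (evens v) = 12"
  and length_odds [simp]: "length (odds v) = 12"
  by (simp_all add: evens_def odds_def)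

lemma evens_nth: "k < 12 \<Longrightarrow> evens v ! k = v $ of_nat (2 * k)"
  and odds_nth: "k < 12 \<Longrightarrow> odds v ! k = v $ of_nat (2 * k + 1)"
  by (simp_all add: evens_def odds_def)

lemma evens_odds_eqI:
  assumes "evens u = evens v" "odds u = odds v"
  shows "u = v"
proof (rule vec_eq_iff [THEN iffD2], rule allI)
  fix i :: 24
  obtain n where n: "n < 24" "i = of_nat n" using ex_of_nat_24 by blast
  show "u $ i = v $ i"
  proof (cases "even n")
    case True
    then obtain k where "n = 2 * k" by auto
    with n assms(1) evens_nth [of k u] evens_nth [of k v] show ?thesis by auto
  next
    case False
    then obtain k where "n = 2 * k + 1" by (auto elim: oddE)
    with n assms(2) odds_nth [of k u] odds_nth [of k v] show ?thesis by auto
  qed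
qed

lemma sum_lessThan_double:
  fixes f :: "nat \<Rightarrow> 'a::comm_monoid_add"
  shows "(\<Sum>n<2 * m. f n) = (\<Sum>k<m. f (2 * k)) + (\<Sum>k<m. f (2 * k + 1))"
  by (induction m) (simp_all add: ac_simps)

lemma list_weight_map:
  "list_weight (map f [0..<m]) = (\<Sum>k<m. if f k \<noteq> 0 then 1 else 0)"
  by (induction m) (simp_all add: list_weight_def)

lemma hamming_weight_evens_odds:
  "hamming_weight v = list_weight (evens v) + list_weight (odds v)"
proof -
  have "hamming_weight v = (\<Sum>i\<in>UNIV. if v $ i \<noteq> 0 then 1 else 0)"
    by (simp add: hamming_weight_def sum.If_cases)
  also have "\<dots> = (\<Sum>n<2 * 12. if v $ of_nat n \<noteq> 0 then 1 else 0)"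
    by (simp add: sum_UNIV_24)
  also have "\<dots> = list_weight (evens v) + list_weight (odds v)"
    unfolding sum_lessThan_double evens_def odds_def list_weight_map ..
  finally show ?thesis .
qed

definition list_add :: "gf4 list \<Rightarrow> gf4 list \<Rightarrow> gf4 list" where
  "list_add xs ys = map2 (+) xs ys"

lemma length_list_add [simp]: "length (list_add xs ys) = min (length xs) (length ys)"
  by (simp add: list_add_def)

lemma evens_add: "evens (u + v) = list_add (evens u) (evens v)"
  and odds_add: "odds (u + v) = list_add (odds u) (odds v)"
  by (rule nth_equalityI; simp add: list_add_def evens_nth odds_nth)+

subsection \<open>The code in systematic form\<close>

text \<open>The odd half of the codeword whose even half is 1, 0, ..., 0.\<close>

definition check_row :: "gf4 list" where
  "check_row = [GFw, GFw, GFw, GF1, GF1, GFw2, GF0, GFw2, GF0, GFw, GFw, GF0]"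

text \<open>With a list read as a polynomial modulo X^12 - 1, the rotation is multiplication by
  X^-1. In a word of length 12 the contribution of position k is rotated 12 - k times, that is,
  multiplied by X^k.\<close>

definition encode_step :: "gf4 \<Rightarrow> gf4 list \<Rightarrow> gf4 list" where
  "encode_step c s = rotate1 (map2 (\<lambda>a b. a + c * b) s check_row)"

fun encode :: "gf4 list \<Rightarrow> gf4 list \<Rightarrow> gf4 list" where
  "encode [] s = s"
| "encode (x # xs) s = encode xs (encode_step (conj_gf4 x) s)"

abbreviation zeros :: "gf4 list" where "zeros \<equiv> replicate 12 0"

text \<open>\<open>encode\<close> multiplies the conjugate of its first argument by the circulant matrix with
  first row \<open>check_row\<close>, in the form of Horner's scheme.\<close>

definition systematic_code :: "(gf4 ^ 24) set" where
  "systematic_code = {v. odds v = encode (evens v) zeros}"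

lemma length_check_row [simp]: "length check_row = 12"
  by (simp add: check_row_def)

lemma length_encode_step [simp]: "length s = 12 \<Longrightarrow> length (encode_step c s) = 12"
  by (simp add: encode_step_def)

lemma length_encode [simp]: "length s = 12 \<Longrightarrow> length (encode xs s) = 12"
  by (induction xs arbitrary: s) simp_all

lemma encode_step_add:
  assumes "length s = 12" "length t = 12"
  shows "encode_step (c + d) (list_add s t) = list_add (encode_step c s) (encode_step d t)"
proof (rule nth_equalityI)
  fix i assume "i < length (encode_step (c + d) (list_add s t))"
  then have i: "i < 12" using assms by simp
  have "Suc i mod 12 < 12" by simp
  then show "encode_step (c + d) (list_add s t) ! i =
      list_add (encode_step c s) (encode_step d t) ! i"
    using assms i by (simp add: encode_step_def list_add_def nth_rotate1 algebra_simps)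
qed (use assms in simp)

lemma encode_add:
  assumes "length xs = length ys" "length s = 12" "length t = 12"
  shows "encode (list_add xs ys) (list_add s t) = list_add (encode xs s) (encode ys t)"
  using assms
proof (induction xs ys arbitrary: s t rule: list_induct2)
  case Nil
  then show ?case by (simp add: list_add_def)
next
  case (Cons x xs y ys)
  have "list_add (x # xs) (y # ys) = (x + y) # list_add xs ys"
    by (simp add: list_add_def)
  then show ?case using Cons
    by (simp add: conj_gf4_add encode_step_add)
qed

lemma zeros_add: "list_add zeros zeros = zeros"
  by (simp add: list_add_def zip_replicate)

lemma encode_step_zeros: "encode_step 0 zeros = zeros"
  by (rule nth_equalityI) (simp_all add: encode_step_def nth_rotate1)

lemma encode_zeros: "encode (replicate n 0) zeros = zeros"
  by (induction n) (simp_all add: encode_step_zeros)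

lemma evens_0: "evens 0 = zeros" and odds_0: "odds 0 = zeros"
  by (simp_all add: evens_def odds_def map_replicate_const)

lemma zero_in_systematic: "0 \<in> systematic_code"
  by (simp add: systematic_code_def evens_0 odds_0 encode_zeros)

lemma add_in_systematic:
  "u \<in> systematic_code \<Longrightarrow> v \<in> systematic_code \<Longrightarrow> u + v \<in> systematic_code"
  using encode_add [of "evens u" "evens v" zeros zeros]
  by (simp add: systematic_code_def evens_add odds_add zeros_add)

text \<open>The displayed word rotated by one place, because its last entry has index 24 =
  0.\<close>

definition gen24_list :: "gf4 list" where
  "gen24_list = [GF0, GFw, GF0, GF1, GF1, GF0, GF1, GF1, GF1, GF1, GF1, GF1, GF1,
      GF1, GF1, GF1, GF0, GF1, GF0, GF0, GF0, GF0, GF1, GF1]"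

lemma all_less_24:
  "(\<forall>n<24. P (n::nat)) \<longleftrightarrow> P 0 \<and> P 1 \<and> P 2 \<and> P 3 \<and> P 4 \<and> P 5 \<and> P 6 \<and> P 7 \<and> P 8 \<and> P 9 \<and> P 10 \<and> P 11
    \<and> P 12 \<and> P 13 \<and> P 14 \<and> P 15 \<and> P 16 \<and> P 17 \<and> P 18 \<and> P 19 \<and> P 20 \<and> P 21 \<and> P 22 \<and> P 23"
  by (simp add: numeral_eq_Suc All_less_Suc conj_ac)

lemma gen24_nth_all: "\<forall>n<24. gen24 $ of_nat n = gen24_list ! n"
  unfolding all_less_24
  by (simp add: gen24_def vector_def gen24_list_def gf4_eval(1,2))

lemma gen24_nth: "gen24 $ of_nat n = gen24_list ! (n mod 24)"
proof -
  have "(of_nat n :: 24) = of_nat (n mod 24)" by (simp add: of_nat_24_eq_iff)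
  then show ?thesis using gen24_nth_all by simp
qed

text \<open>Adding 24 - k in place of subtracting k keeps the index a natural number, ready for
  reduction modulo 24.\<close>

lemma cyclic_shift_nth_24:
  fixes v :: "gf4 ^ 24"
  assumes "k < 24"
  shows "cyclic_shift (of_nat k) v $ of_nat n = v $ of_nat (n + (24 - k))"
proof -
  have "(of_nat (n + (24 - k)) :: 24) = of_nat n + of_nat 24 - of_nat k"
    using assms by (simp only: of_nat_add of_nat_diff less_imp_le) simp
  also have "(of_nat 24 :: 24) = of_nat 0" unfolding of_nat_24_eq_iff by simp
  finally have "(of_nat (n + (24 - k)) :: 24) = of_nat n - of_nat k" by simp
  then show ?thesis by (simp only: cyclic_shift_def vec_lambda_beta)
qed

text \<open>A finite check on the generators; additivity of the systematic code extends it to their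
  span.\<close>

lemma shifts_systematic_all:
  "\<forall>k\<in>set [0..<24]. map (\<lambda>j. gen24_list ! ((2 * j + 1 + (24 - k)) mod 24)) [0..<12] =
    encode (map (\<lambda>j. gen24_list ! ((2 * j + (24 - k)) mod 24)) [0..<12]) zeros"
  by code_simp

lemma cyclic_shift_gen24_systematic: "cyclic_shift k gen24 \<in> systematic_code"
proof -
  obtain n where n: "n < 24" "k = of_nat n" using ex_of_nat_24 by blast
  have "evens (cyclic_shift k gen24) = map (\<lambda>j. gen24_list ! ((2 * j + (24 - n)) mod 24)) [0..<12]"
    unfolding evens_def n(2) cyclic_shift_nth_24 [OF n(1)] gen24_nth ..
  moreover have "odds (cyclic_shift k gen24) =
      map (\<lambda>j. gen24_list ! ((2 * j + 1 + (24 - n)) mod 24)) [0..<12]"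
    unfolding odds_def n(2) cyclic_shift_nth_24 [OF n(1)] gen24_nth ..
  ultimately show ?thesis
    using shifts_systematic_all n(1) by (simp add: systematic_code_def)
qed

lemma code24_subset_systematic: "code24 \<subseteq> systematic_code"
proof
  fix v assume "v \<in> code24"
  then show "v \<in> systematic_code"
    unfolding code24_def circulant_code_def
    by (induction rule: group_closure.induct)
      (auto simp: zero_in_systematic add_in_systematic cyclic_shift_gen24_systematic)
qed

section \<open>The size of the code\<close>

lemma card_gf4_lists: "card {xs :: gf4 list. length xs = n} = 4 ^ n"
  using card_lists_length_eq [of "UNIV :: gf4 set" n] by (simp add: gf4_elements(2))

lemma inj_on_evens_systematic: "inj_on evens systematic_code"
  by (rule inj_onI) (auto simp: systematic_code_def intro: evens_odds_eqI)

lemma card_systematic_le: "card systematic_code \<le> 2 ^ 24"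
proof -
  have "card systematic_code = card (evens ` systematic_code)"
    by (simp add: card_image inj_on_evens_systematic)
  also have "\<dots> \<le> card {xs :: gf4 list. length xs = 12}"
    by (rule card_mono) (auto intro: finite_lists_length_eq [of UNIV, simplified])
  finally show ?thesis by (simp add: card_gf4_lists)
qed

text \<open>Each shift of the generator has nonzero trace in a single coordinate, so adding it to a
  codeword inserts one prescribed element into the support of the traces.\<close>

lemma code24_trace_support:
  "\<exists>c\<in>code24. {i. trace_gf4 (c $ i) \<noteq> 0} = S" for S :: "24 set"
proof (induction S rule: finite_induct [OF finite])
  case 1
  show ?case by (rule bexI [of _ 0]) (simp_all add: code24_def circulant_code_def)
next
  case (2 j S)
  then obtain c where c: "c \<in> code24" "{i. trace_gf4 (c $ i) \<noteq> 0} = S" by blast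
  \<comment> \<open>The entry omega sits at index 1 of \<open>gen24\<close>, hence at index j after
    this shift.\<close>
  let ?g = "cyclic_shift (j - 1) gen24"
  have "?g \<in> code24"
    unfolding code24_def circulant_code_def by (rule group_closure.base) blast
  with c(1) have mem: "c + ?g \<in> code24"
    unfolding code24_def circulant_code_def by (rule group_closure_add)
  have gen: "\<forall>n<24. trace_gf4 (gen24 $ of_nat n) = (if n = 1 then 1 else 0)"
    unfolding all_less_24 gen24_nth by (simp add: gen24_list_def gf4_eval)
  have g: "trace_gf4 (?g $ i) = (if i = j then 1 else 0)" for i
  proof -
    obtain n where n: "n < 24" "i - (j - 1) = of_nat n" using ex_of_nat_24 by blast
    have "i = j \<longleftrightarrow> i - (j - 1) = 1" by (metis add_diff_cancel_left' diff_diff_eq2 diff_add_cancel)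
    also have "\<dots> \<longleftrightarrow> of_nat n = (of_nat 1 :: 24)" by (simp add: n(2))
    also have "\<dots> \<longleftrightarrow> n = 1" using n(1) unfolding of_nat_24_eq_iff by simp
    finally show ?thesis using gen n by (simp add: cyclic_shift_def)
  qed
  have "{i. trace_gf4 ((c + ?g) $ i) \<noteq> 0} = insert j S"
    using c(2) 2(2) by (auto simp: trace_gf4_add g split: if_splits)
  with mem show ?case by blast
qed

lemma card_code24_ge: "2 ^ 24 \<le> card code24"
proof -
  have "(UNIV :: 24 set set) \<subseteq> (\<lambda>c. {i. trace_gf4 (c $ i) \<noteq> 0}) ` code24"
  proof
    fix S :: "24 set"
    obtain c where "c \<in> code24" "{i. trace_gf4 (c $ i) \<noteq> 0} = S"
      using code24_trace_support by blast
    then show "S \<in> (\<lambda>c. {i. trace_gf4 (c $ i) \<noteq> 0}) ` code24" by blast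
  qed
  then have "card (UNIV :: 24 set set) \<le> card code24"
    by (meson card_image_le card_mono finite finite_imageI le_trans)
  then show ?thesis by (simp add: card_UNIV_set)
qed

text \<open>The lower bound for the smaller set meets the upper bound for the larger one.\<close>

lemma code24_eq_systematic: "code24 = systematic_code"
  and card_code24: "card code24 = 2 ^ 24"
proof -
  show "code24 = systematic_code"
    using card_code24_ge card_systematic_le code24_subset_systematic
    by (meson card_subset_eq dual_order.trans card_mono finite le_antisym)
  then show "card code24 = 2 ^ 24"
    using card_code24_ge card_systematic_le by simp
qed

lemma bij_betw_evens_code24: "bij_betw evens code24 {xs. length xs = 12}"
proof -
  have "evens ` code24 = {xs. length xs = 12}"
  proof (rule card_subset_eq)
    show "card (evens ` code24) = card {xs :: gf4 list. length xs = 12}"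
      using card_image [OF inj_on_evens_systematic] card_code24
      by (simp add: code24_eq_systematic card_gf4_lists)
  qed (auto intro: finite_lists_length_eq [of UNIV, simplified])
  then show ?thesis
    using inj_on_evens_systematic by (simp add: bij_betw_def code24_eq_systematic)
qed

lemma code24_iff: "v \<in> code24 \<longleftrightarrow> odds v = encode (evens v) zeros"
  by (simp add: code24_eq_systematic systematic_code_def)

lemma zero_in_code24: "0 \<in> code24"
  by (simp add: code24_eq_systematic zero_in_systematic)

lemma add_in_code24: "u \<in> code24 \<Longrightarrow> v \<in> code24 \<Longrightarrow> u + v \<in> code24"
  by (simp add: code24_eq_systematic add_in_systematic)

lemma cyclic_shift_code24: "v \<in> code24 \<Longrightarrow> cyclic_shift k v \<in> code24"
  unfolding code24_def circulant_code_def
proof (induction rule: group_closure.induct)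
  case (base s)
  have "cyclic_shift k (cyclic_shift j gen24) = cyclic_shift (k + j) gen24" for j
    by (simp add: cyclic_shift_def vec_eq_iff diff_diff_eq)
  moreover have "cyclic_shift k 0 = (0 :: gf4 ^ 24)"
    by (simp add: cyclic_shift_def vec_eq_iff)
  ultimately show ?case using base by (auto intro: group_closure.base)
next
  case (diff s t)
  have "cyclic_shift k (s - t) = cyclic_shift k s - cyclic_shift k t"
    by (simp add: cyclic_shift_def vec_eq_iff)
  then show ?case using diff by (metis group_closure.diff)
qed

subsection \<open>Duality and power moments\<close>

definition trace_form :: "gf4 ^ 'n \<Rightarrow> gf4 ^ 'n \<Rightarrow> gf4" where
  "trace_form u v = (\<Sum>i\<in>UNIV. trace_gf4 (u $ i * conj_gf4 (v $ i)))"

lemma trace_form_add_left: "trace_form (u + v) w = trace_form u w + trace_form v w"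
  and trace_form_add_right: "trace_form w (u + v) = trace_form w u + trace_form w v"
  by (simp_all add: trace_form_def distrib_left distrib_right conj_gf4_add trace_gf4_add sum.distrib)

lemma trace_form_0 [simp]: "trace_form 0 w = 0" "trace_form w 0 = 0"
  by (simp_all add: trace_form_def)

lemma trace_gf4_cases: "trace_gf4 x = 0 \<or> trace_gf4 x = 1"
  by (cases x) (simp_all add: gf4_eval)

lemma trace_form_cases: "trace_form u v = 0 \<or> trace_form u v = 1"
proof -
  have "(\<Sum>i\<in>A. trace_gf4 (f i)) = 0 \<or> (\<Sum>i\<in>A. trace_gf4 (f i)) = 1" if "finite A"
    for A and f :: "'a \<Rightarrow> gf4"
    using that
  proof induction
    case (insert a A)
    with trace_gf4_cases [of "f a"] show ?case by auto
  qed simp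
  then show ?thesis by (simp add: trace_form_def)
qed

lemma dual_code_iff: "u \<in> dual_code C \<longleftrightarrow> (\<forall>c\<in>C. trace_form u c = 0)"
  by (simp add: dual_code_def trace_form_def)

text \<open>On the values 0 and 1 of the trace this is the nontrivial additive character of
  GF(2).\<close>

definition gf4_sign :: "gf4 \<Rightarrow> int" where
  "gf4_sign x = (if x = 0 then 1 else -1)"

text \<open>Orthogonality of characters: translation by an element with value 1 permutes G and
  negates every term, so the sum equals its own negative.\<close>

lemma character_sum:
  fixes G :: "(gf4 ^ 'n) set"
  assumes G: "additive_subgroup G"
    and add: "\<And>u v. \<phi> (u + v) = \<phi> u + \<phi> v"
    and val: "\<And>u. \<phi> u = 0 \<or> \<phi> u = 1"
  shows "(\<Sum>g\<in>G. gf4_sign (\<phi> g)) = (if \<forall>g\<in>G. \<phi> g = 0 then int (card G) else 0)"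
proof (cases "\<forall>g\<in>G. \<phi> g = 0")
  case True
  then show ?thesis by (simp add: gf4_sign_def)
next
  case False
  then obtain h where h: "h \<in> G" "\<phi> h = 1" using val by blast
  have "bij_betw ((+) h) G G"
    by (rule bij_betw_byWitness [where f' = "(+) h"])
      (use G h in \<open>auto simp: additive_subgroup_def\<close>)
  then have "(\<Sum>g\<in>G. gf4_sign (\<phi> g)) = (\<Sum>g\<in>G. gf4_sign (\<phi> (h + g)))"
    by (rule sum.reindex_bij_betw [symmetric])
  also have "\<dots> = (\<Sum>g\<in>G. - gf4_sign (\<phi> g))"
  proof (rule sum.cong)
    fix g
    show "gf4_sign (\<phi> (h + g)) = - gf4_sign (\<phi> g)"
      using val [of g] h(2) by (auto simp: add gf4_sign_def)
  qed simp
  also have "\<dots> = - (\<Sum>g\<in>G. gf4_sign (\<phi> g))" by (rule sum_negf)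
  finally show ?thesis using False by auto
qed

text \<open>Both sides evaluate the sum of the signs of \<open>trace_form v c\<close> over all
  pairs, once with c and once with v as the inner variable.\<close>

lemma card_dual_inter:
  fixes C V :: "(gf4 ^ 'n) set"
  assumes C: "additive_subgroup C" and V: "additive_subgroup V"
  shows "card C * card {v\<in>V. \<forall>c\<in>C. trace_form v c = 0} =
    card V * card {c\<in>C. \<forall>v\<in>V. trace_form v c = 0}"
proof -
  have "int (card C * card {v\<in>V. \<forall>c\<in>C. trace_form v c = 0}) =
      (\<Sum>v\<in>V. \<Sum>c\<in>C. gf4_sign (trace_form v c))"
    by (simp add: character_sum [OF C trace_form_add_right trace_form_cases] sum.If_cases Int_def)
  also have "\<dots> = (\<Sum>c\<in>C. \<Sum>v\<in>V. gf4_sign (trace_form v c))"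
    by (rule sum.swap)
  also have "\<dots> = int (card V * card {c\<in>C. \<forall>v\<in>V. trace_form v c = 0})"
    by (simp add: character_sum [OF V trace_form_add_left trace_form_cases] sum.If_cases Int_def)
  finally show ?thesis by linarith
qed

section \<open>Binomial moments of a code and its dual\<close>

definition supported_on :: "'n set \<Rightarrow> (gf4 ^ 'n) set" where
  "supported_on T = {v. \<forall>i. i \<notin> T \<longrightarrow> v $ i = 0}"

lemma additive_subgroup_supported_on: "additive_subgroup (supported_on T)"
  by (simp add: additive_subgroup_def supported_on_def)

lemma card_supported_on: "card (supported_on T) = 4 ^ card (T :: 'n::finite set)"
proof -
  have "bij_betw (\<lambda>f. \<chi> i. if i \<in> T then f i else 0) (T \<rightarrow>\<^sub>E (UNIV :: gf4 set)) (supported_on T)"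
  proof (rule bij_betw_byWitness [where f' = "\<lambda>v. restrict (($) v) T"])
    show "\<forall>f\<in>T \<rightarrow>\<^sub>E UNIV. restrict (($) (\<chi> i. if i \<in> T then f i else (0 :: gf4))) T = f"
    proof (intro ballI ext)
      fix f :: "'n \<Rightarrow> gf4" and i assume f: "f \<in> T \<rightarrow>\<^sub>E UNIV"
      show "restrict (($) (\<chi> i. if i \<in> T then f i else (0 :: gf4))) T i = f i"
        by (cases "i \<in> T") (simp_all add: PiE_arb [OF f])
    qed
    show "\<forall>v\<in>supported_on T. (\<chi> i. if i \<in> T then restrict (($) v) T i else 0) = v"
      by (simp add: supported_on_def vec_eq_iff)
    show "(\<lambda>f. \<chi> i. if i \<in> T then f i else 0) ` (T \<rightarrow>\<^sub>E UNIV) \<subseteq> supported_on T"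
      by (intro image_subsetI) (simp add: supported_on_def)
    show "(\<lambda>v. restrict (($) v) T) ` supported_on T \<subseteq> T \<rightarrow>\<^sub>E UNIV"
      by (intro image_subsetI restrict_PiE_iff [THEN iffD2]) simp
  qed
  then have "card (supported_on T) = card (T \<rightarrow>\<^sub>E (UNIV :: gf4 set))"
    by (simp add: bij_betw_same_card)
  then show ?thesis by (simp add: card_PiE gf4_elements(2))
qed

lemma trace_form_supported_on:
  "(\<forall>v\<in>supported_on T. trace_form v c = 0) \<longleftrightarrow> (\<forall>i\<in>T. c $ i = 0)"
proof
  assume L: "\<forall>v\<in>supported_on T. trace_form v c = 0"
  show "\<forall>i\<in>T. c $ i = 0"
  proof (rule ballI, rule ccontr)
    fix i assume i: "i \<in> T" "c $ i \<noteq> 0"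
    \<comment> \<open>A nonzero entry times its conjugate is 1, so the factor omega makes the trace
      Tr(omega) = 1.\<close>
    let ?v = "axis i (\<omega> * c $ i)"
    have "?v \<in> supported_on T" using i by (auto simp: supported_on_def axis_def)
    moreover have "trace_form ?v c = trace_gf4 (\<omega> * c $ i * conj_gf4 (c $ i))"
    proof -
      have "trace_form ?v c =
          (\<Sum>j\<in>UNIV. if j = i then trace_gf4 (\<omega> * c $ i * conj_gf4 (c $ i)) else 0)"
        unfolding trace_form_def by (rule sum.cong) (auto simp: axis_def)
      then show ?thesis by simp
    qed
    moreover have "trace_gf4 (\<omega> * c $ i * conj_gf4 (c $ i)) = 1"
      using i(2) by (cases "c $ i") (simp_all add: gf4_eval)
    ultimately show False using L by auto
  qed
next
  assume "\<forall>i\<in>T. c $ i = 0"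
  then have "v $ i = 0 \<or> c $ i = 0" if "v \<in> supported_on T" for v i
    using that by (auto simp: supported_on_def)
  then show "\<forall>v\<in>supported_on T. trace_form v c = 0"
    unfolding trace_form_def by (intro ballI sum.neutral) (metis conj_gf4_0 mult_zero_left mult_zero_right trace_gf4_0)
qed

lemma card_Compl: "card (- T) = CARD('n) - card T" for T :: "'n::finite set"
  by (simp add: Compl_eq_Diff_UNIV card_Diff_subset)

text \<open>Double counting of the pairs of a codeword and an s-element set of its zero
  coordinates.\<close>

lemma sum_card_vanishing:
  fixes C :: "(gf4 ^ 'n) set"
  shows "(\<Sum>T | card T = s. card {c\<in>C. \<forall>i\<in>T. c $ i = 0}) =
    (\<Sum>c\<in>C. (CARD('n) - hamming_weight c) choose s)"
proof -
  have "(\<Sum>T | card T = s. card {c\<in>C. \<forall>i\<in>T. c $ i = 0}) =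
      (\<Sum>T | card T = s. \<Sum>c\<in>C. if \<forall>i\<in>T. c $ i = 0 then 1 else 0)"
    by (simp add: sum.If_cases Int_def)
  also have "\<dots> = (\<Sum>c\<in>C. \<Sum>T | card T = s. if \<forall>i\<in>T. c $ i = 0 then 1 else 0)"
    by (rule sum.swap)
  also have "\<dots> = (\<Sum>c\<in>C. (CARD('n) - hamming_weight c) choose s)"
  proof (rule sum.cong)
    fix c :: "gf4 ^ 'n"
    have "(\<Sum>T | card T = s. if \<forall>i\<in>T. c $ i = 0 then 1 else 0) =
        card {T. T \<subseteq> {i. c $ i = 0} \<and> card T = s}"
      by (simp add: sum.If_cases Int_def subset_eq conj_commute)
    also have "\<dots> = card {i. c $ i = 0} choose s"
      by (simp add: n_subsets)
    also have "{i. c $ i = 0} = - {i. c $ i \<noteq> 0}" by auto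
    also have "card \<dots> = CARD('n) - hamming_weight c"
      by (simp add: card_Compl hamming_weight_def)
    finally show "(\<Sum>T | card T = s. if \<forall>i\<in>T. c $ i = 0 then 1 else 0) =
        (CARD('n) - hamming_weight c) choose s" by simp
  qed simp
  finally show ?thesis .
qed

text \<open>Orthogonality to everything supported on T means vanishing on T, so
  \<open>card_dual_inter\<close> relates the dual words that live on T to the codewords that avoid
  T.\<close>

lemma card_dual_supported_on:
  fixes C :: "(gf4 ^ 'n) set"
  assumes C: "additive_subgroup C"
  shows "card C * card {v\<in>dual_code C. \<forall>i\<in>- T. v $ i = 0} =
    4 ^ card T * card {c\<in>C. \<forall>i\<in>T. c $ i = 0}"
proof -
  have "{v\<in>dual_code C. \<forall>i\<in>- T. v $ i = 0} =
      {v\<in>supported_on T. \<forall>c\<in>C. trace_form v c = 0}"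
    by (auto simp: dual_code_iff supported_on_def)
  then show ?thesis
    using card_dual_inter [OF C additive_subgroup_supported_on [of T]]
    by (simp add: trace_form_supported_on card_supported_on)
qed

lemma card_mult_card_dual:
  fixes C :: "(gf4 ^ 'n) set"
  assumes C: "additive_subgroup C"
  shows "card C * card (dual_code C) = 4 ^ CARD('n)"
proof -
  have "{c\<in>C. \<forall>i\<in>UNIV. c $ i = 0} = {0}"
    using C by (auto simp: vec_eq_iff additive_subgroup_def)
  then show ?thesis using card_dual_supported_on [OF C, of UNIV] by simp
qed

text \<open>The MacWilliams identities in binomial form: \<open>card_dual_supported_on\<close> is
  summed over all T of size t, and complementation turns the left-hand sets into sets of CARD('n) -
  t zeros.\<close>

lemma power_moments_dual:
  fixes C :: "(gf4 ^ 'n) set"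
  assumes C: "additive_subgroup C" and t: "t \<le> CARD('n)"
  shows "card C * (\<Sum>v\<in>dual_code C. (CARD('n) - hamming_weight v) choose (CARD('n) - t)) =
    4 ^ t * (\<Sum>c\<in>C. (CARD('n) - hamming_weight c) choose t)"
proof -
  have "(\<Sum>v\<in>dual_code C. (CARD('n) - hamming_weight v) choose (CARD('n) - t)) =
      (\<Sum>T | card T = CARD('n) - t. card {v\<in>dual_code C. \<forall>i\<in>T. v $ i = 0})"
    by (rule sum_card_vanishing [symmetric])
  also have "\<dots> = (\<Sum>T | card T = t. card {v\<in>dual_code C. \<forall>i\<in>- T. v $ i = 0})"
    by (rule sum.reindex_bij_witness [where i = uminus and j = uminus])
      (use t in \<open>auto simp: card_Compl\<close>)
  finally have "card C * (\<Sum>v\<in>dual_code C. (CARD('n) - hamming_weight v) choose (CARD('n) - t)) =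
      (\<Sum>T | card T = t. 4 ^ t * card {c\<in>C. \<forall>i\<in>T. c $ i = 0})"
    by (simp add: sum_distrib_left card_dual_supported_on [OF C])
  then show ?thesis
    by (simp add: sum_distrib_left [symmetric] sum_card_vanishing)
qed

lemma sum_hamming_weight:
  fixes C :: "(gf4 ^ 'n) set"
  shows "(\<Sum>c\<in>C. f (hamming_weight c)) = (\<Sum>i\<le>CARD('n). weight_count C i * f i)"
proof -
  have "hamming_weight c \<le> CARD('n)" for c :: "gf4 ^ 'n"
    by (simp add: hamming_weight_def card_mono)
  then have "(\<Sum>i\<le>CARD('n). \<Sum>c | c \<in> C \<and> hamming_weight c = i. f (hamming_weight c)) =
      (\<Sum>c\<in>C. f (hamming_weight c))"
    by (intro sum.group) auto
  then show ?thesis by (simp add: weight_count_def)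
qed


subsection \<open>Isoduality\<close>

text \<open>In characteristic 2 the equal terms at i and \<tau> i cancel; the linear order selects
  one index of each pair.\<close>

lemma sum_involution_eq_0:
  fixes h :: "'n::{finite, linorder} \<Rightarrow> gf4"
  assumes inv: "\<And>i. \<tau> (\<tau> i) = i" and h: "\<And>i. h (\<tau> i) = h i" and fixpt: "\<And>i. \<tau> i = i \<Longrightarrow> h i = 0"
  shows "(\<Sum>i\<in>UNIV. h i) = 0"
proof -
  have "(\<Sum>i\<in>UNIV. h i) = (\<Sum>i | i < \<tau> i. h i) + (\<Sum>i | \<tau> i \<le> i. h i)"
    by (subst sum.union_disjoint [symmetric]) (auto intro!: arg_cong [of _ _ "sum h"])
  also have "(\<Sum>i | \<tau> i \<le> i. h i) = (\<Sum>i | \<tau> i < i. h i)"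
    by (rule sum.mono_neutral_right) (auto simp: fixpt le_less)
  also have "\<dots> = (\<Sum>i | i < \<tau> i. h i)"
    by (rule sum.reindex_bij_witness [where i = \<tau> and j = \<tau>]) (auto simp: inv h)
  finally show ?thesis by simp
qed

definition reverse_coords :: "gf4 ^ ('n::{finite, comm_ring_1}) \<Rightarrow> gf4 ^ ('n::{finite, comm_ring_1})" where
  "reverse_coords v = (\<chi> i. v $ (- i))"

lemma reverse_coords_involution [simp]: "reverse_coords (reverse_coords v) = v"
  by (simp add: reverse_coords_def vec_eq_iff)

lemma reverse_coords_add: "reverse_coords (u + v) = reverse_coords u + reverse_coords v"
  by (simp add: reverse_coords_def vec_eq_iff)

lemma trace_gf4_conj_commute: "trace_gf4 (x * conj_gf4 y) = trace_gf4 (y * conj_gf4 x)"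
  by (cases x; cases y) (simp_all add: gf4_eval)

lemma trace_gf4_self_conj: "trace_gf4 (x * conj_gf4 x) = 0"
  by (cases x) (simp_all add: gf4_eval)

text \<open>The involution exchanges the two entries of g that are multiplied at i. The trace form
  is symmetric in them, and at a fixed point they agree and give trace 0.\<close>

lemma trace_form_reverse_shifts:
  fixes g :: "gf4 ^ ('n::{finite, comm_ring_1, linorder})"
  shows "trace_form (reverse_coords (cyclic_shift k g)) (cyclic_shift l g) = 0"
  unfolding trace_form_def
proof (rule sum_involution_eq_0 [where \<tau> = "\<lambda>i. l - k - i"])
  fix i :: 'n
  have "- (l - k - i) - k = i - l" "l - k - i - l = - i - k" by (simp_all add: algebra_simps)
  then show "trace_gf4 (reverse_coords (cyclic_shift k g) $ (l - k - i) *
        conj_gf4 (cyclic_shift l g $ (l - k - i))) =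
      trace_gf4 (reverse_coords (cyclic_shift k g) $ i * conj_gf4 (cyclic_shift l g $ i))"
    by (simp only: reverse_coords_def cyclic_shift_def vec_lambda_beta
        trace_gf4_conj_commute [of "g $ (i - l)"])
  assume "l - k - i = i"
  then have "- i - k = i - l" by (metis add_diff_cancel_left' diff_diff_eq2 diff_add_cancel minus_diff_eq uminus_add_conv_diff diff_right_commute add.commute)
  then show "trace_gf4 (reverse_coords (cyclic_shift k g) $ i * conj_gf4 (cyclic_shift l g $ i)) = 0"
    by (simp only: reverse_coords_def cyclic_shift_def vec_lambda_beta trace_gf4_self_conj)
qed simp

lemma reverse_coords_circulant_subset_dual:
  fixes g :: "gf4 ^ ('n::{finite, comm_ring_1, linorder})"
  shows "reverse_coords ` circulant_code g \<subseteq> dual_code (circulant_code g)"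
proof -
  have "trace_form (reverse_coords u) v = 0"
    if u: "u \<in> circulant_code g" and v: "v \<in> circulant_code g" for u v
    using u unfolding circulant_code_def
  proof (induction rule: group_closure.induct)
    case (base s)
    have zero: "reverse_coords 0 = (0 :: gf4 ^ ('n::{finite, comm_ring_1, linorder}))" by (simp add: reverse_coords_def vec_eq_iff)
    show ?case
      using v unfolding circulant_code_def
    proof (induction rule: group_closure.induct)
      case (base t)
      with \<open>s \<in> _\<close> show ?case by (auto simp: trace_form_reverse_shifts zero)
    next
      case (diff s t)
      then show ?case by (simp add: trace_form_add_right)
    qed
  next
    case (diff s t)
    then show ?case by (simp add: reverse_coords_add trace_form_add_left)
  qed
  then show ?thesis by (auto simp: dual_code_iff)
qed

lemma additive_subgroup_code24: "additive_subgroup code24"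
  by (simp add: additive_subgroup_def zero_in_code24 add_in_code24)

text \<open>Reversal is injective and the dual has 4^24 / 2^24 = 2^24 elements, so the inclusion is
  an equality.\<close>

lemma reverse_coords_code24: "reverse_coords ` code24 = dual_code code24"
proof (rule card_subset_eq)
  show "reverse_coords ` code24 \<subseteq> dual_code code24"
    unfolding code24_def by (rule reverse_coords_circulant_subset_dual)
  have "card (reverse_coords ` code24) = card code24"
    by (rule card_image) (metis inj_on_inverseI reverse_coords_involution)
  moreover have "card code24 * card (dual_code code24) = 4 ^ 24"
    using card_mult_card_dual [OF additive_subgroup_code24] by simp
  ultimately show "card (reverse_coords ` code24) = card (dual_code code24)"
    by (simp add: card_code24)
qed simp

lemma isodual_code24: "isodual code24"
proof -
  have "bij (uminus :: 24 \<Rightarrow> 24)" by (metis bijI' minus_equation_iff)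
  moreover have "reverse_coords = coord_map uminus (\<lambda>_ :: 24. 1) {}"
    by (simp add: fun_eq_iff reverse_coords_def coord_map_def)
  ultimately have "(reverse_coords :: gf4 ^ 24 \<Rightarrow> _) \<in> equivalence_maps"
    unfolding equivalence_maps_def mem_Collect_eq
    by (intro exI [of _ uminus] exI [of _ "\<lambda>_. 1"] exI [of _ "{}"]) simp
  then show ?thesis
    unfolding isodual_def equivalent_codes_def using reverse_coords_code24 by blast
qed

lemma hamming_weight_reverse_coords:
  "hamming_weight (reverse_coords v) = hamming_weight v"
proof -
  have "{i. v $ (- i) \<noteq> 0} = uminus ` {i. v $ i \<noteq> 0}"
    by (auto simp: image_iff) (metis minus_minus)
  then show ?thesis
    by (simp add: hamming_weight_def reverse_coords_def card_image)
qed

text \<open>Reversal preserves weights, so the moments of the dual are again expressed by the weight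
  counts of the code itself.\<close>

lemma power_moments_code24:
  assumes "t \<le> 24"
  shows "2 ^ 24 * (\<Sum>i\<le>24. weight_count code24 i * ((24 - i) choose (24 - t))) =
    4 ^ t * (\<Sum>i\<le>24. weight_count code24 i * ((24 - i) choose t))"
proof -
  have "(\<Sum>v\<in>dual_code code24. (24 - hamming_weight v) choose (24 - t)) =
      (\<Sum>v\<in>code24. (24 - hamming_weight v) choose (24 - t))"
    unfolding reverse_coords_code24 [symmetric]
    by (subst sum.reindex)
      (simp_all add: hamming_weight_reverse_coords inj_on_inverseI [of _ reverse_coords])
  then show ?thesis
    using power_moments_dual [OF additive_subgroup_code24, of t] assms
      sum_hamming_weight [of "\<lambda>w. (24 - w) choose (24 - t)" code24]
      sum_hamming_weight [of "\<lambda>w. (24 - w) choose t" code24]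
    by (simp add: card_code24)
qed

subsection \<open>Enumerating words of low weight\<close>

fun words :: "nat \<Rightarrow> nat \<Rightarrow> gf4 list list" where
  "words 0 n = [replicate n 0]"
| "words (Suc i) 0 = []"
| "words (Suc i) (Suc n) = map ((#) 0) (words (Suc i) n) @ map ((#) GF1) (words i n) @
     map ((#) GFw) (words i n) @ map ((#) GFw2) (words i n)"

text \<open>Representatives of the nonzero words up to scalars, normalized to have first nonzero
  entry 1.\<close>

fun lead_words :: "nat \<Rightarrow> nat \<Rightarrow> gf4 list list" where
  "lead_words i 0 = []"
| "lead_words 0 (Suc n) = []"
| "lead_words (Suc i) (Suc n) = map ((#) 0) (lead_words (Suc i) n) @ map ((#) GF1) (words i n)"

lemma list_weight_simps [simp]:
  "list_weight [] = 0"
  "list_weight (x # xs) = (if x = 0 then list_weight xs else Suc (list_weight xs))"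
  by (simp_all add: list_weight_def)

lemma list_weight_eq_0_iff: "list_weight xs = 0 \<longleftrightarrow> xs = replicate (length xs) 0"
  by (induction xs) auto

lemma gf4_nonzero [simp]: "GF1 \<noteq> 0" "GFw \<noteq> 0" "GFw2 \<noteq> 0"
  by (simp_all add: zero_gf4_def)

lemma set_words: "set (words i n) = {xs. length xs = n \<and> list_weight xs = i}"
proof (induction i n rule: words.induct)
  case (1 n)
  then show ?case by (auto simp: list_weight_eq_0_iff)
next
  case (3 i n)
  have "xs \<in> set (words (Suc i) (Suc n)) \<longleftrightarrow> length xs = Suc n \<and> list_weight xs = Suc i" for xs
  proof (cases xs)
    case (Cons x ys)
    then show ?thesis using 3 by (cases x) (auto simp: zero_gf4_def)
  qed auto
  then show ?case by blast
qed auto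

lemma distinct_words: "distinct (words i n)"
  by (induction i n rule: words.induct)
    (auto simp: distinct_map zero_gf4_def)

lemma encode_step_0: "length s = 12 \<Longrightarrow> encode_step 0 s = rotate1 s"
  by (rule nth_equalityI) (simp_all add: encode_step_def nth_rotate1)

lemma list_weight_rotate1: "list_weight (rotate1 s) = list_weight s"
  by (cases s) (simp_all add: list_weight_def)

text \<open>Trailing zeros merely rotate the state, so an enumeration may stop once all nonzero
  entries are placed.\<close>

lemma list_weight_encode_replicate_0:
  "length s = 12 \<Longrightarrow> list_weight (encode (replicate n 0) s) = list_weight s"
  by (induction n arbitrary: s) (simp_all add: encode_step_0 list_weight_rotate1)

definition count_encoded :: "nat \<Rightarrow> nat \<Rightarrow> gf4 list \<Rightarrow> nat \<Rightarrow> nat" where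
  "count_encoded i n s j = length (filter (\<lambda>xs. list_weight (encode xs s) = j) (words i n))"

lemma count_encoded_Suc:
  "count_encoded (Suc i) (Suc n) s j = count_encoded (Suc i) n (encode_step 0 s) j +
     count_encoded i n (encode_step GF1 s) j + count_encoded i n (encode_step GFw s) j +
     count_encoded i n (encode_step GFw2 s) j"
  by (simp add: count_encoded_def filter_map comp_def)

lemma encode_step_scale:
  "length s = 12 \<Longrightarrow> encode_step (c * d) (map ((*) c) s) = map ((*) c) (encode_step d s)"
  by (rule nth_equalityI) (simp_all add: encode_step_def nth_rotate1 algebra_simps)

lemma list_weight_scale: "c \<noteq> 0 \<Longrightarrow> list_weight (map ((*) c) s) = list_weight s"
  by (induction s) auto

text \<open>Scaling the initial state by c amounts to scaling the word; in the recursion, division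
  by c permutes the three branches with a nonzero first entry.\<close>

lemma count_encoded_scale:
  assumes "c \<noteq> 0" "length s = 12"
  shows "count_encoded i n (map ((*) c) s) j = count_encoded i n s j"
  using assms(2)
proof (induction i n arbitrary: s rule: words.induct)
  case (1 n)
  then show ?case
    by (simp add: count_encoded_def list_weight_encode_replicate_0 list_weight_scale assms(1))
next
  case (2 i)
  then show ?case by (simp add: count_encoded_def)
next
  case (3 i n)
  have scale: "encode_step d (map ((*) c) s) = map ((*) c) (encode_step (inverse c * d) s)" for d
    using encode_step_scale [OF 3(5), of c "inverse c * d"] assms(1)
    by (simp add: mult.assoc [symmetric])
  have len: "length (encode_step d s) = 12" for d using 3(5) by simp
  have scaled: "count_encoded (Suc i) (Suc n) (map ((*) c) s) j =
      count_encoded (Suc i) n (encode_step (inverse c * 0) s) j +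
      count_encoded i n (encode_step (inverse c * GF1) s) j +
      count_encoded i n (encode_step (inverse c * GFw) s) j +
      count_encoded i n (encode_step (inverse c * GFw2) s) j"
    by (simp only: count_encoded_Suc scale 3(1) [OF len] 3(2) [OF len])
  have "c = GF1 \<or> c = GFw \<or> c = GFw2"
    using assms(1) by (cases c) (auto simp: zero_gf4_def)
  then show ?case
    unfolding scaled count_encoded_Suc [of i n s] by (elim disjE) simp_all
qed

definition count_lead :: "nat \<Rightarrow> nat \<Rightarrow> nat \<Rightarrow> nat" where
  "count_lead i n j = length (filter (\<lambda>xs. list_weight (encode xs zeros) = j) (lead_words i n))"

text \<open>Leading zeros keep the state zero, so at the first nonzero entry the three resulting
  states are scalar multiples of each other and contribute equally.\<close>

lemma count_encoded_lead: "count_encoded (Suc i) n zeros j = 3 * count_lead (Suc i) n j"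
proof (induction n)
  case 0
  then show ?case by (simp add: count_encoded_def count_lead_def)
next
  case (Suc n)
  have scale: "encode_step c zeros = map ((*) c) (encode_step GF1 zeros)" for c
    using encode_step_scale [of zeros c GF1] by (simp add: one_gf4_def [symmetric])
  have "count_lead (Suc i) (Suc n) j = count_lead (Suc i) n j + count_encoded i n (encode_step GF1 zeros) j"
    by (simp add: count_lead_def count_encoded_def filter_map comp_def encode_step_zeros)
  moreover have "count_encoded i n (encode_step GFw zeros) j = count_encoded i n (encode_step GF1 zeros) j"
    "count_encoded i n (encode_step GFw2 zeros) j = count_encoded i n (encode_step GF1 zeros) j"
    by (subst scale, simp add: count_encoded_scale)+
  ultimately show ?case
    using Suc by (simp add: count_encoded_Suc encode_step_zeros)
qed

text \<open>Histograms are lists of counts in which missing entries stand for 0; \<open>weight_bin b L w\<close> has the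
  single entry \<open>w - b\<close> and is empty unless \<open>b \<le> w < b + L\<close>. The recursions are laid out for
  evaluation by rewriting: \<open>b\<close>, \<open>w\<close> and \<open>L\<close> are unary, and there is no accumulator,
  since the simplifier would traverse it again at every step.\<close>

fun hist_nth :: "nat list \<Rightarrow> nat \<Rightarrow> nat" where
  "hist_nth [] j = 0"
| "hist_nth (x # xs) 0 = x"
| "hist_nth (x # xs) (Suc j) = hist_nth xs j"

fun hist_add :: "nat list \<Rightarrow> nat list \<Rightarrow> nat list" where
  "hist_add [] h = h"
| "hist_add (x # xs) [] = x # xs"
| "hist_add (x # xs) (y # ys) = (x + y) # hist_add xs ys"

fun hist_shift :: "nat list \<Rightarrow> nat list" where
  "hist_shift [] = []"
| "hist_shift (x # xs) = 0 # x # xs"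

fun weight_bin :: "nat \<Rightarrow> nat \<Rightarrow> nat \<Rightarrow> nat list" where
  "weight_bin (Suc b) L (Suc w) = weight_bin b L w"
| "weight_bin (Suc b) L 0 = []"
| "weight_bin 0 0 w = []"
| "weight_bin 0 (Suc L) 0 = [1]"
| "weight_bin 0 (Suc L) (Suc w) = hist_shift (weight_bin 0 L w)"

lemma hist_nth_add: "hist_nth (hist_add g h) j = hist_nth g j + hist_nth h j"
proof (induction g h arbitrary: j rule: hist_add.induct)
  case (3 x xs y ys)
  then show ?case by (cases j) simp_all
qed simp_all

lemma hist_nth_shift: "hist_nth (hist_shift h) j = (case j of 0 \<Rightarrow> 0 | Suc k \<Rightarrow> hist_nth h k)"
  by (cases h) (auto split: nat.splits)

lemma hist_nth_weight_bin:
  "j < L \<Longrightarrow> hist_nth (weight_bin b L w) j = (if w = b + j then 1 else 0)"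
  by (induction b L w arbitrary: j rule: weight_bin.induct)
    (auto simp: hist_nth_shift less_Suc_eq_0_disj split: nat.splits)

definition tally :: "nat \<Rightarrow> nat \<Rightarrow> nat \<Rightarrow> nat \<Rightarrow> gf4 list \<Rightarrow> nat list" where
  "tally b L i n s =
     foldr (\<lambda>xs. hist_add (weight_bin b L (list_weight (encode xs s)))) (words i n) []"

definition lead_tally :: "nat \<Rightarrow> nat \<Rightarrow> nat \<Rightarrow> nat \<Rightarrow> nat list" where
  "lead_tally b L i n =
     foldr (\<lambda>xs. hist_add (weight_bin b L (list_weight (encode xs zeros)))) (lead_words i n) []"

lemma hist_nth_foldr:
  "j < L \<Longrightarrow> hist_nth (foldr (\<lambda>xs. hist_add (weight_bin b L (f xs))) ws []) j =
     length (filter (\<lambda>xs. f xs = b + j) ws)"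
  by (induction ws) (simp_all add: hist_nth_add hist_nth_weight_bin)

lemma hist_nth_lead_tally: "j < L \<Longrightarrow> hist_nth (lead_tally b L i n) j = count_lead i n (b + j)"
  by (simp add: lead_tally_def count_lead_def hist_nth_foldr)

lemma hist_add_assoc: "hist_add (hist_add f g) h = hist_add f (hist_add g h)"
  by (induction f g arbitrary: h rule: hist_add.induct) (simp, simp, case_tac h, simp_all)

lemma hist_add_Nil [simp]: "hist_add h [] = h"
  by (cases h) simp_all

lemma foldr_hist_add:
  "foldr (\<lambda>xs. hist_add (f xs)) (us @ vs) [] =
     hist_add (foldr (\<lambda>xs. hist_add (f xs)) us []) (foldr (\<lambda>xs. hist_add (f xs)) vs [])"
  by (induction us) (simp_all add: hist_add_assoc)

text \<open>The explicit list stands in for the premise that the state has length 12 and makes this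
  an unconditional rewrite rule.\<close>

lemma tally_0: "tally b L 0 n [a0,a1,a2,a3,a4,a5,a6,a7,a8,a9,a10,a11] =
    weight_bin b L (list_weight [a0,a1,a2,a3,a4,a5,a6,a7,a8,a9,a10,a11])"
  by (simp add: tally_def list_weight_encode_replicate_0 del: list_weight_simps)

text \<open>Words with a common prefix share the computation of its state. As \<open>encode\<close>
  conjugates, the entry omega uses the step with \<open>GFw2\<close> and vice versa.\<close>

lemma tally_Suc:
  "tally b L (Suc i) 0 s = []"
  "tally b L (Suc i) (Suc n) s =
     hist_add (tally b L (Suc i) n (encode_step GF0 s)) (hist_add (tally b L i n (encode_step GF1 s))
       (hist_add (tally b L i n (encode_step GFw2 s)) (tally b L i n (encode_step GFw s))))"
  unfolding zero_gf4_def [symmetric]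
  by (simp_all add: tally_def foldr_hist_add foldr_map comp_def del: foldr_append)

lemma lead_tally_Suc:
  "lead_tally b L (Suc i) 0 = []"
  "lead_tally b L (Suc i) (Suc n) =
     hist_add (lead_tally b L (Suc i) n) (tally b L i n (encode_step GF1 zeros))"
  by (simp_all add: tally_def lead_tally_def foldr_hist_add foldr_map comp_def encode_step_zeros del: foldr_append)

lemma gf4_add_GF0: "x + GF0 = x"
  by (simp add: zero_gf4_def)

lemma encode_step_rules:
  "encode_step GF0 [a0,a1,a2,a3,a4,a5,a6,a7,a8,a9,a10,a11] = [a1,a2,a3,a4,a5,a6,a7,a8,a9,a10,a11,a0]"
  "encode_step GF1 [a0,a1,a2,a3,a4,a5,a6,a7,a8,a9,a10,a11] =
    [a1 + GFw, a2 + GFw, a3 + GF1, a4 + GF1, a5 + GFw2, a6, a7 + GFw2, a8, a9 + GFw, a10 + GFw, a11, a0 + GFw]"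
  "encode_step GFw [a0,a1,a2,a3,a4,a5,a6,a7,a8,a9,a10,a11] =
    [a1 + GFw2, a2 + GFw2, a3 + GFw, a4 + GFw, a5 + GF1, a6, a7 + GF1, a8, a9 + GFw2, a10 + GFw2, a11, a0 + GFw2]"
  "encode_step GFw2 [a0,a1,a2,a3,a4,a5,a6,a7,a8,a9,a10,a11] =
    [a1 + GF1, a2 + GF1, a3 + GFw2, a4 + GFw2, a5 + GFw, a6, a7 + GFw, a8, a9 + GF1, a10 + GF1, a11, a0 + GF1]"
  by (simp_all add: encode_step_def check_row_def gf4_add_GF0)

lemma zeros_eval: "zeros = [GF0,GF0,GF0,GF0,GF0,GF0,GF0,GF0,GF0,GF0,GF0,GF0]"
  by (simp add: numeral_eq_Suc zero_gf4_def)

lemma gf4_add_table: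
  "GF0 + GF0 = (GF0::gf4)" "GF0 + GF1 = GF1" "GF0 + GFw = GFw" "GF0 + GFw2 = GFw2"
  "GF1 + GF0 = GF1" "GF1 + GF1 = GF0" "GF1 + GFw = GFw2" "GF1 + GFw2 = GFw"
  "GFw + GF0 = GFw" "GFw + GF1 = GFw2" "GFw + GFw = GF0" "GFw + GFw2 = GF1"
  "GFw2 + GF0 = GFw2" "GFw2 + GF1 = GFw" "GFw2 + GFw = GF1" "GFw2 + GFw2 = GF0"
  by (simp_all add: zero_gf4_def)

lemma list_weight_rules:
  "list_weight [] = 0"
  "list_weight (GF0 # xs) = list_weight xs"
  "list_weight (GF1 # xs) = Suc (list_weight xs)"
  "list_weight (GFw # xs) = Suc (list_weight xs)"
  "list_weight (GFw2 # xs) = Suc (list_weight xs)"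
  by (simp_all add: zero_gf4_def)


lemmas tally_eval = tally_0 tally_Suc lead_tally_Suc encode_step_rules weight_bin.simps hist_add.simps
  hist_shift.simps list_weight_rules zeros_eval gf4_add_table
  add_0_left add_0_right one_plus_numeral numeral_plus_one one_add_one add_num_simps numeral_plus_numeral

abbreviation twelve :: nat where
  "twelve \<equiv> Suc (Suc (Suc (Suc (Suc (Suc (Suc (Suc (Suc (Suc (Suc (Suc 0)))))))))))"

text \<open>For even-half weight i the window is i <= j <= 12 - i, of length 13 - 2 i: smaller j
  follow from the symmetry of the halves, larger j give total weight above 12. Final zeros of the
  histogram are absent.\<close>

lemma lead_tally_1:
  "lead_tally (Suc 0)
     (Suc (Suc (Suc (Suc (Suc (Suc (Suc (Suc (Suc (Suc (Suc 0))))))))))) (Suc 0) twelve = [0, 0, 0, 0, 0, 0, 0, 0, 12]"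
  by (simp only: tally_eval)

lemma lead_tally_2:
  "lead_tally (Suc (Suc 0))
     (Suc (Suc (Suc (Suc (Suc (Suc (Suc (Suc (Suc 0))))))))) (Suc (Suc 0)) twelve = [0, 0, 0, 0, 0, 24, 48, 36, 48]"
  by (simp only: tally_eval)

lemma lead_tally_3:
  "lead_tally (Suc (Suc (Suc 0)))
     (Suc (Suc (Suc (Suc (Suc (Suc (Suc 0))))))) (Suc (Suc (Suc 0))) twelve = [0, 0, 0, 100, 276, 276, 544]"
  by (simp only: tally_eval)

lemma lead_tally_4:
  "lead_tally (Suc (Suc (Suc (Suc 0))))
     (Suc (Suc (Suc (Suc (Suc 0))))) (Suc (Suc (Suc (Suc 0)))) twelve = [0, 168, 738, 1344, 2484]"
  by (simp only: tally_eval)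

lemma lead_tally_5:
  "lead_tally (Suc (Suc (Suc (Suc (Suc 0)))))
     (Suc (Suc (Suc 0))) (Suc (Suc (Suc (Suc (Suc 0))))) twelve = [768, 2688, 6168]"
  by (simp only: tally_eval)

lemma lead_tally_6:
  "lead_tally (Suc (Suc (Suc (Suc (Suc (Suc 0))))))
     (Suc 0) (Suc (Suc (Suc (Suc (Suc (Suc 0)))))) twelve = [8648]"
  by (simp only: tally_eval)

lemma twelve_eq: "twelve = 12"
  by simp


subsection \<open>The weight distribution\<close>

definition weight_pair :: "nat \<Rightarrow> nat \<Rightarrow> nat" where
  "weight_pair i j = card {v\<in>code24. list_weight (evens v) = i \<and> list_weight (odds v) = j}"

text \<open>\<open>evens\<close> is a bijection from the code onto all words of length 12, so a
  condition on both halves is counted by filtering a list without repetitions.\<close>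

lemma card_code24_words:
  "card {v\<in>code24. list_weight (evens v) = i \<and> P (evens v) (odds v)} =
     length (filter (\<lambda>xs. P xs (encode xs zeros)) (words i 12))"
proof -
  let ?A = "{v\<in>code24. list_weight (evens v) = i \<and> P (evens v) (odds v)}"
  let ?W = "filter (\<lambda>xs. P xs (encode xs zeros)) (words i 12)"
  have "bij_betw evens ?A (set ?W)"
  proof (rule bij_betw_imageI)
    show "inj_on evens ?A"
      using bij_betw_evens_code24 by (auto simp: bij_betw_def intro: inj_on_subset)
    show "evens ` ?A = set ?W"
    proof (intro equalityI subsetI)
      fix xs assume "xs \<in> evens ` ?A"
      then show "xs \<in> set ?W" by (auto simp: set_words code24_iff)
    next
      fix xs assume xs: "xs \<in> set ?W"
      then have "xs \<in> evens ` code24"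
        using bij_betw_evens_code24 by (auto simp: bij_betw_def set_words)
      with xs show "xs \<in> evens ` ?A" by (auto simp: set_words code24_iff)
    qed
  qed
  then have "card ?A = card (set ?W)" by (rule bij_betw_same_card)
  also have "\<dots> = length ?W" by (simp only: distinct_card distinct_filter distinct_words)
  finally show ?thesis .
qed

lemma weight_pair_count_encoded: "weight_pair i j = count_encoded i 12 zeros j"
  unfolding weight_pair_def count_encoded_def by (rule card_code24_words)

lemma cyclic_shift_cyclic_shift: "cyclic_shift k (cyclic_shift l v) = cyclic_shift (k + l) v"
  by (simp add: cyclic_shift_def vec_eq_iff diff_diff_eq)

lemma cyclic_shift_0 [simp]: "cyclic_shift 0 v = v"
  by (simp add: cyclic_shift_def vec_eq_iff)

lemma inj_cyclic_shift: "inj (cyclic_shift k)"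
  by (rule inj_on_inverseI [of _ "cyclic_shift (- k)"]) (simp add: cyclic_shift_cyclic_shift)

lemma hamming_weight_cyclic_shift: "hamming_weight (cyclic_shift k v) = hamming_weight v"
proof -
  have "{i. v $ (i - k) \<noteq> 0} = (\<lambda>i. i + k) ` {i. v $ i \<noteq> 0}"
    by (auto simp: image_iff) (metis diff_add_cancel)
  then show ?thesis
    by (simp add: hamming_weight_def cyclic_shift_def card_image)
qed

lemma odds_cyclic_shift_1: "odds (cyclic_shift 1 v) = evens v"
  by (simp add: odds_def evens_def cyclic_shift_def)

lemma list_weight_cyclic_shift_1:
  "list_weight (odds (cyclic_shift 1 v)) = list_weight (evens v)"
  "list_weight (evens (cyclic_shift 1 v)) = list_weight (odds v)"
  \<comment> \<open>Invariance of the total weight yields the second equation without describing how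
    the odd half is rotated.\<close>
  using hamming_weight_cyclic_shift [of 1 v]
  by (simp_all add: hamming_weight_evens_odds odds_cyclic_shift_1)

lemma weight_pair_commute: "weight_pair i j = weight_pair j i"
proof -
  have "weight_pair i j \<le> weight_pair j i" for i j
    unfolding weight_pair_def
    by (rule card_inj_on_le [of "cyclic_shift 1"])
      (auto simp: list_weight_cyclic_shift_1 cyclic_shift_code24 intro: inj_on_subset [OF inj_cyclic_shift])
  then show ?thesis by (simp add: le_antisym)
qed

lemma weight_count_code24: "weight_count code24 w = (\<Sum>i\<le>w. weight_pair i (w - i))"
proof -
  have "weight_count code24 w = (\<Sum>v | v \<in> code24 \<and> hamming_weight v = w. 1)"
    by (simp add: weight_count_def)
  also have "\<dots> = (\<Sum>i\<le>w. \<Sum>v | v \<in> {v\<in>code24. hamming_weight v = w} \<and> list_weight (evens v) = i. 1)"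
    by (rule sum.group [symmetric]) (auto simp: hamming_weight_evens_odds)
  also have "\<dots> = (\<Sum>i\<le>w. weight_pair i (w - i))"
    unfolding weight_pair_def
    by (intro sum.cong refl) (auto simp: hamming_weight_evens_odds intro!: arg_cong [of _ _ card])
  finally show ?thesis .
qed

text \<open>Row \<open>i\<close> lists \<open>weight_pair i j\<close> for \<open>i \<le> j \<le> 12 - i\<close>.\<close>

definition pair_table :: "nat list list" where
  "pair_table = [
    [1, 0, 0, 0, 0, 0, 0, 0, 0, 0, 0, 0, 0],
    [0, 0, 0, 0, 0, 0, 0, 0, 36, 0, 0],
    [0, 0, 0, 0, 0, 72, 144, 108, 144],
    [0, 0, 0, 300, 828, 828, 1632],
    [0, 504, 2214, 4032, 7452],
    [2304, 8064, 18504],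
    [25944]]"

lemmas upt_numeral_rec = upt_rec [of 0 "numeral n" for n] upt_rec [of "Suc 0" "numeral n" for n]
  upt_rec_numeral numeral_2_eq_2 [symmetric]

lemma hist_nth_numeral:
  "hist_nth (x # xs) (numeral k) = hist_nth xs (pred_numeral k)" "hist_nth (x # xs) 1 = hist_nth xs 0"
  by (simp_all add: numeral_eq_Suc)

text \<open>The factor 3 restores the scalar multiples. The premises \<open>i = m\<close> and
  \<open>M = L\<close> connect decimal numerals with the unary ones of the evaluated
  tallies.\<close>

lemma weight_pair_row:
  assumes "lead_tally m L m twelve = h" "list_all (\<lambda>k. r ! k = 3 * hist_nth h k) [0..<M]"
    and "i = m" "0 < i" "M = L" "k < M"
  shows "weight_pair i (i + k) = r ! k"
proof -
  obtain l where l: "m = Suc l" using assms by (cases m) auto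
  have "hist_nth h k = count_lead m 12 (m + k)"
    using hist_nth_lead_tally [of k L m m twelve] assms(1,5,6) unfolding twelve_eq by simp
  then show ?thesis
    using assms(2,3,6) by (simp add: l weight_pair_count_encoded count_encoded_lead list_all_iff)
qed

lemma weight_pair_table:
  assumes "i \<le> j" "i + j \<le> 12"
  shows "weight_pair i j = pair_table ! i ! (j - i)"
proof -
  consider "i = 0" | k where "j = 1 + k" "k < 11" "i = 1" | k where "j = 2 + k" "k < 9" "i = 2"
    | k where "j = 3 + k" "k < 7" "i = 3" | k where "j = 4 + k" "k < 5" "i = 4"
    | k where "j = 5 + k" "k < 3" "i = 5" | k where "j = 6 + k" "k < 1" "i = 6"
  proof -
    have "i = 0 \<or> i = 1 \<or> i = 2 \<or> i = 3 \<or> i = 4 \<or> i = 5 \<or> i = 6" using assms by arith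
    moreover have "j = i + (j - i)" "j - i < 13 - 2 * i" using assms by auto
    ultimately show ?thesis using that by (elim disjE) simp_all
  qed
  then show ?thesis
  proof cases
    case 1
    have "weight_pair 0 j = (if j = 0 then 1 else 0)"
      by (simp add: weight_pair_count_encoded count_encoded_def encode_zeros list_weight_def)
    with 1 assms show ?thesis
      by (auto simp: pair_table_def nth_Cons split: nat.splits)
  next
    case (2 k)
    have tab: "list_all (\<lambda>k. pair_table ! 1 ! k = 3 * hist_nth [0, 0, 0, 0, 0, 0, 0, 0, 12] k) [0..<11]"
      by (simp add: upt_numeral_rec pair_table_def hist_nth_numeral)
    show ?thesis
      using weight_pair_row [OF lead_tally_1 tab, of 1 k] 2 by simp
  next
    case (3 k)
    have tab: "list_all (\<lambda>k. pair_table ! 2 ! k = 3 * hist_nth [0, 0, 0, 0, 0, 24, 48, 36, 48] k) [0..<9]"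
      by (simp add: upt_numeral_rec pair_table_def hist_nth_numeral)
    show ?thesis
      using weight_pair_row [OF lead_tally_2 tab, of 2 k] 3 by simp
  next
    case (4 k)
    have tab: "list_all (\<lambda>k. pair_table ! 3 ! k = 3 * hist_nth [0, 0, 0, 100, 276, 276, 544] k) [0..<7]"
      by (simp add: upt_numeral_rec pair_table_def hist_nth_numeral)
    show ?thesis
      using weight_pair_row [OF lead_tally_3 tab, of 3 k] 4 by simp
  next
    case (5 k)
    have tab: "list_all (\<lambda>k. pair_table ! 4 ! k = 3 * hist_nth [0, 168, 738, 1344, 2484] k) [0..<5]"
      by (simp add: upt_numeral_rec pair_table_def hist_nth_numeral)
    show ?thesis
      using weight_pair_row [OF lead_tally_4 tab, of 4 k] 5 by simp
  next
    case (6 k)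
    have tab: "list_all (\<lambda>k. pair_table ! 5 ! k = 3 * hist_nth [768, 2688, 6168] k) [0..<3]"
      by (simp add: upt_numeral_rec pair_table_def hist_nth_numeral)
    show ?thesis
      using weight_pair_row [OF lead_tally_5 tab, of 5 k] 6 by simp
  next
    case (7 k)
    have tab: "list_all (\<lambda>k. pair_table ! 6 ! k = 3 * hist_nth [8648] k) [0..<1]"
      by (simp add: upt_numeral_rec pair_table_def hist_nth_numeral)
    show ?thesis
    proof -
      have "weight_pair 6 (6 + 0) = pair_table ! 6 ! 0"
        by (rule weight_pair_row [OF lead_tally_6 tab]) simp_all
      then show ?thesis using 7 by simp
    qed
  qed
qed

lemma weight_count_code24_table:
  assumes "w \<le> 12"
  shows "weight_count code24 w = (\<Sum>i\<le>w. pair_table ! min i (w - i) ! (max i (w - i) - min i (w - i)))"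
  unfolding weight_count_code24
proof (rule sum.cong)
  fix i assume "i \<in> {..w}"
  then show "weight_pair i (w - i) = pair_table ! min i (w - i) ! (max i (w - i) - min i (w - i))"
    using weight_pair_table [of "min i (w - i)" "max i (w - i)"] assms weight_pair_commute [of i]
    by (auto simp: min_def max_def)
qed simp

lemma weight_count_code24_le_12:
  "map (weight_count code24) [0..<13] = [1, 0, 0, 0, 0, 0, 0, 0, 0, 1752, 8748, 26064, 81408]"
proof -
  have "map (weight_count code24) [0..<13] = map (\<lambda>w. \<Sum>i\<le>w.
      pair_table ! min i (w - i) ! (max i (w - i) - min i (w - i))) [0..<13]"
    by (rule map_cong) (auto simp: weight_count_code24_table)
  also have "\<dots> = [1, 0, 0, 0, 0, 0, 0, 0, 0, 1752, 8748, 26064, 81408]"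
    by (simp add: upt_numeral_rec pair_table_def atMost_nat_numeral)
  finally show ?thesis .
qed

text \<open>Quotients of factorials evaluate the coefficients of the moments without Pascal's
  recursion.\<close>

lemma choose_numeral_eq:
  "numeral n choose numeral k = (if (numeral k :: nat) \<le> numeral n
     then fact (numeral n) div (fact (numeral k) * fact (numeral n - numeral k)) else 0)"
  by (simp add: binomial_fact' not_le)

lemmas moment_eval = atMost_nat_numeral choose_numeral_eq fact_numeral upt_numeral_rec binomial_eq_0

text \<open>The power moment of order \<open>t\<close> is a linear equation whose only unknown is the number of words
  of weight \<open>24 - t\<close>, once all smaller weights are known.\<close>

lemma weight_count_code24_13: "weight_count code24 13 = 232776"
  using power_moments_code24 [of 11] weight_count_code24_le_12
  by (simp add: moment_eval)

lemma weight_count_code24_14: "weight_count code24 14 = 573516"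
  using power_moments_code24 [of 10] weight_count_code24_le_12
  by (simp add: moment_eval weight_count_code24_13)

lemma weight_count_code24_15: "weight_count code24 15 = 1119264"
  using power_moments_code24 [of 9] weight_count_code24_le_12
  by (simp add: moment_eval weight_count_code24_13 weight_count_code24_14)

lemma weight_count_code24_16: "weight_count code24 16 = 1869777"
  using power_moments_code24 [of 8] weight_count_code24_le_12
  by (simp add: moment_eval weight_count_code24_13 weight_count_code24_14 weight_count_code24_15)

lemma weight_count_code24_17: "weight_count code24 17 = 2676456"
  using power_moments_code24 [of 7] weight_count_code24_le_12
  by (simp add: moment_eval weight_count_code24_13 weight_count_code24_14 weight_count_code24_15 weight_count_code24_16)

lemma weight_count_code24_18: "weight_count code24 18 = 3096804"
  using power_moments_code24 [of 6] weight_count_code24_le_12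
  by (simp add: moment_eval weight_count_code24_13 weight_count_code24_14 weight_count_code24_15 weight_count_code24_16 weight_count_code24_17)

lemma weight_count_code24_19: "weight_count code24 19 = 2959056"
  using power_moments_code24 [of 5] weight_count_code24_le_12
  by (simp add: moment_eval weight_count_code24_13 weight_count_code24_14 weight_count_code24_15 weight_count_code24_16 weight_count_code24_17 weight_count_code24_18)

lemma weight_count_code24_20: "weight_count code24 20 = 2204568"
  using power_moments_code24 [of 4] weight_count_code24_le_12
  by (simp add: moment_eval weight_count_code24_13 weight_count_code24_14 weight_count_code24_15 weight_count_code24_16 weight_count_code24_17 weight_count_code24_18 weight_count_code24_19)

lemma weight_count_code24_21: "weight_count code24 21 = 1255416"
  using power_moments_code24 [of 3] weight_count_code24_le_12
  by (simp add: moment_eval weight_count_code24_13 weight_count_code24_14 weight_count_code24_15 weight_count_code24_16 weight_count_code24_17 weight_count_code24_18 weight_count_code24_19 weight_count_code24_20)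

lemma weight_count_code24_22: "weight_count code24 22 = 520740"
  using power_moments_code24 [of 2] weight_count_code24_le_12
  by (simp add: moment_eval weight_count_code24_13 weight_count_code24_14 weight_count_code24_15 weight_count_code24_16 weight_count_code24_17 weight_count_code24_18 weight_count_code24_19 weight_count_code24_20 weight_count_code24_21)

lemma weight_count_code24_23: "weight_count code24 23 = 134208"
  using power_moments_code24 [of 1] weight_count_code24_le_12
  by (simp add: moment_eval weight_count_code24_13 weight_count_code24_14 weight_count_code24_15 weight_count_code24_16 weight_count_code24_17 weight_count_code24_18 weight_count_code24_19 weight_count_code24_20 weight_count_code24_21 weight_count_code24_22)

lemma weight_count_code24_24: "weight_count code24 24 = 16662"
  using power_moments_code24 [of 0] weight_count_code24_le_12
  by (simp add: moment_eval weight_count_code24_13 weight_count_code24_14 weight_count_code24_15 weight_count_code24_16 weight_count_code24_17 weight_count_code24_18 weight_count_code24_19 weight_count_code24_20 weight_count_code24_21 weight_count_code24_22 weight_count_code24_23)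

lemmas weight_counts = weight_count_code24_13 weight_count_code24_14 weight_count_code24_15 weight_count_code24_16 weight_count_code24_17 weight_count_code24_18 weight_count_code24_19 weight_count_code24_20 weight_count_code24_21 weight_count_code24_22 weight_count_code24_23 weight_count_code24_24

lemma weight_enumerator_code24:
  "weight_enumerator code24 1 y =
        1 + 1752 * y^9 + 8748 * y^10 + 26064 * y^11 + 81408 * y^12 + 232776 * y^13
        + 573516 * y^14 + 1119264 * y^15 + 1869777 * y^16 + 2676456 * y^17
        + 3096804 * y^18 + 2959056 * y^19 + 2204568 * y^20 + 1255416 * y^21
        + 520740 * y^22 + 134208 * y^23 + 16662 * y^24" for y :: "'a :: comm_semiring_1"
  using weight_count_code24_le_12
  by (simp add: weight_enumerator_def atMost_nat_numeral upt_numeral_rec weight_counts add_ac)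

lemma min_weight_code24: "min_weight code24 = 9"
  unfolding min_weight_def
proof (rule Min_eqI)
  fix w assume "w \<in> hamming_weight ` (code24 - {0})"
  then obtain v where v: "v \<in> code24" "v \<noteq> 0" "w = hamming_weight v" by blast
  then have "0 < w"
    by (simp add: hamming_weight_def card_gt_0_iff vec_eq_iff)
  moreover have "weight_count code24 w \<noteq> 0"
    using v by (auto simp: weight_count_def)
  moreover have "w = 0 \<or> weight_count code24 w = 0" if "w < 9"
  proof -
    have "w \<in> {0, 1, 2, 3, 4, 5, 6, 7, 8}" using that by auto
    then show ?thesis using weight_count_code24_le_12 by (auto simp: upt_numeral_rec)
  qed
  ultimately show "9 \<le> w" by (cases "w < 9") auto
next
  have "weight_count code24 9 \<noteq> 0"
    using weight_count_code24_le_12 by (simp add: upt_numeral_rec)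
  then obtain v where "v \<in> code24" "hamming_weight v = 9"
    by (auto simp: weight_count_def card_eq_0_iff)
  moreover from this have "v \<noteq> 0" by (auto simp: hamming_weight_def)
  ultimately show "9 \<in> hamming_weight ` (code24 - {0})" by (metis DiffI image_eqI singletonD)
qed simp

lemma additive_code_code24: "additive_code 24 24 9 code24"
proof -
  have "code24 \<noteq> {0}"
  proof
    assume "code24 = {0}"
    then have "card code24 = card {0 :: gf4 ^ 24}" by (rule arg_cong)
    then show False by (simp add: card_code24)
  qed
  then show ?thesis
    by (simp add: additive_code_def additive_subgroup_code24 card_code24 min_weight_code24)
qed

subsection \<open>Isometries\<close>

text \<open>Every equivalence map has these properties. Together with invariance of the code they
  suffice for the stabilizer, so permutations, scalars and conjugations never have to be composed or
  inverted explicitly.\<close>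

definition isometry :: "(gf4 ^ 'n \<Rightarrow> gf4 ^ 'n) \<Rightarrow> bool" where
  "isometry f \<longleftrightarrow> (\<forall>u v. f (u + v) = f u + f v) \<and> (\<forall>v. hamming_weight (f v) = hamming_weight v)"

lemma isometry_add: "isometry f \<Longrightarrow> f (u + v) = f u + f v"
  and hamming_weight_isometry: "isometry f \<Longrightarrow> hamming_weight (f v) = hamming_weight v"
  by (simp_all add: isometry_def)

lemma hamming_weight_eq_0_iff [simp]: "hamming_weight v = 0 \<longleftrightarrow> v = 0"
  by (simp add: hamming_weight_def vec_eq_iff)

lemma isometry_0: "isometry f \<Longrightarrow> f 0 = 0"
  by (metis hamming_weight_eq_0_iff isometry_def)

text \<open>Only 0 has weight 0, so the kernel is trivial; finiteness supplies surjectivity.\<close>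

lemma isometry_bij: "isometry f \<Longrightarrow> bij f"
proof -
  assume f: "isometry f"
  have "inj f"
  proof (rule injI)
    fix u v assume "f u = f v"
    then have "f (u + v) = 0" using f by (simp add: isometry_add)
    then have "u + v = 0" using f by (metis hamming_weight_eq_0_iff hamming_weight_isometry)
    then show "u = v" by (metis add.right_neutral vec_add_self_left)
  qed
  then show "bij f" using finite_UNIV_inj_surj [of f] by (simp add: bij_def)
qed

lemma isometry_compose: "isometry f \<Longrightarrow> isometry g \<Longrightarrow> isometry (f \<circ> g)"
  by (simp add: isometry_def)

lemma isometry_inv: "isometry f \<Longrightarrow> isometry (inv f)"
proof -
  assume f: "isometry f"
  have f_inv: "f (inv f v) = v" for v
    using isometry_bij [OF f] by (simp add: bij_is_surj surj_f_inv_f)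
  have inv_f: "inv f (f v) = v" for v
    using isometry_bij [OF f] by (simp add: bij_is_inj)
  show "isometry (inv f)"
    unfolding isometry_def
  proof (intro conjI allI)
    fix u v
    show "inv f (u + v) = inv f u + inv f v"
      using isometry_add [OF f, of "inv f u" "inv f v"] by (metis f_inv inv_f)
    show "hamming_weight (inv f v) = hamming_weight v"
      using hamming_weight_isometry [OF f, of "inv f v"] by (simp add: f_inv)
  qed
qed

lemma isometry_coord_map:
  assumes "bij p" "\<And>i. a i \<noteq> 0"
  shows "isometry (coord_map p a S)"
  unfolding isometry_def
proof (intro conjI allI)
  fix u v :: "gf4 ^ 'a"
  show "coord_map p a S (u + v) = coord_map p a S u + coord_map p a S v"
    by (simp add: coord_map_def vec_eq_iff distrib_left conj_gf4_add)
  have "{i. coord_map p a S v $ i \<noteq> 0} = p -` {i. v $ i \<noteq> 0}"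
    by (auto simp: coord_map_def assms)
  then have "hamming_weight (coord_map p a S v) = card (p -` {i. v $ i \<noteq> 0})"
    by (simp only: hamming_weight_def)
  also have "\<dots> = hamming_weight v"
    using assms(1) unfolding hamming_weight_def
    by (intro card_vimage_inj) (auto simp: bij_def)
  finally show "hamming_weight (coord_map p a S v) = hamming_weight v" .
qed

lemma isometry_equivalence: "f \<in> equivalence_maps \<Longrightarrow> isometry f"
  unfolding equivalence_maps_def by (auto intro: isometry_coord_map)

lemma hamming_weight_axis: "y \<noteq> 0 \<Longrightarrow> hamming_weight (axis j y) = 1"
  by (simp add: hamming_weight_def axis_def cong: conj_cong)

lemma hamming_weight_eq_1_iff: "hamming_weight v = 1 \<longleftrightarrow> (\<exists>j y. y \<noteq> 0 \<and> v = axis j y)"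
proof
  assume "hamming_weight v = 1"
  then obtain j where j: "{i. v $ i \<noteq> 0} = {j}"
    unfolding hamming_weight_def by (auto simp: card_1_singleton_iff)
  then have "v = axis j (v $ j)" by (auto simp: vec_eq_iff axis_def)
  with j show "\<exists>j y. y \<noteq> 0 \<and> v = axis j y" by blast
qed (auto simp: hamming_weight_axis)

lemma isometry_axis:
  assumes "isometry f" "y \<noteq> 0"
  obtains k z where "z \<noteq> 0" "f (axis j y) = axis k z"
  using assms by (metis hamming_weight_axis hamming_weight_eq_1_iff hamming_weight_isometry)

lemma axis_add: "axis j (x + y) = axis j x + axis j (y :: gf4)"
  by (simp add: axis_def vec_eq_iff)

lemma isometry_eqI:
  assumes f: "isometry f" and id: "\<And>j y. y \<noteq> 0 \<Longrightarrow> f (axis j y) = axis j y"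
  shows "f v = v"
proof -
  have sum: "f (\<Sum>i\<in>A. g i) = (\<Sum>i\<in>A. f (g i))" if "finite A" for g :: "'a \<Rightarrow> gf4 ^ 'a" and A
    using that by induction (simp_all add: isometry_0 isometry_add f)
  have v: "v = (\<Sum>i\<in>UNIV. axis i (v $ i))"
    by (simp add: vec_eq_iff axis_def)
  have "f (axis i (v $ i)) = axis i (v $ i)" for i
    using id [of "v $ i" i] isometry_0 [OF f] by (cases "v $ i = 0") (simp_all add: axis_def zero_vec_def)
  then show ?thesis
    by (subst (1 2) v) (simp add: sum)
qed

definition meets :: "gf4 ^ 'n \<Rightarrow> gf4 ^ 'n \<Rightarrow> bool" where
  "meets P w \<longleftrightarrow> hamming_weight (w + P) < hamming_weight w"

text \<open>Adding y at j cancels the entry there exactly if it equals y; in all other cases the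
  support does not shrink.\<close>

lemma meets_axis:
  assumes "y \<noteq> 0"
  shows "meets (axis j y) w \<longleftrightarrow> w $ j = y"
proof (cases "w $ j = y")
  case True
  then have "{i. (w + axis j y) $ i \<noteq> 0} = {i. w $ i \<noteq> 0} - {j}"
    by (auto simp: axis_def)
  moreover have "j \<in> {i. w $ i \<noteq> 0}" using True assms by simp
  ultimately have "meets (axis j y) w"
    unfolding meets_def hamming_weight_def by (simp only: card_Diff1_less finite)
  with True show ?thesis by simp
next
  case False
  then have "w $ j + y \<noteq> 0" by (metis add.assoc add.right_neutral gf4_add_self add.left_neutral)
  then have "{i. w $ i \<noteq> 0} \<subseteq> {i. (w + axis j y) $ i \<noteq> 0}"
    by (auto simp: axis_def)
  then have "hamming_weight w \<le> hamming_weight (w + axis j y)"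
    unfolding hamming_weight_def by (simp add: card_mono)
  with False show ?thesis by (simp add: meets_def)
qed

lemma meets_isometry: "isometry f \<Longrightarrow> meets (f P) (f w) \<longleftrightarrow> meets P w"
  by (simp add: meets_def isometry_add [symmetric] hamming_weight_isometry)

text \<open>Stated through \<open>meets\<close> so that it is evidently invariant under isometries.\<close>

definition pair_count :: "gf4 ^ 24 \<Rightarrow> gf4 ^ 24 \<Rightarrow> nat" where
  "pair_count P Q = card {w\<in>code24. hamming_weight w = 9 \<and> meets P w \<and> meets Q w}"

lemma pair_count_isometry:
  assumes f: "isometry f" "f ` code24 = code24"
  shows "pair_count (f P) (f Q) = pair_count P Q"
proof -
  have "f ` {w\<in>code24. hamming_weight w = 9 \<and> meets P w \<and> meets Q w} =
      {w\<in>code24. hamming_weight w = 9 \<and> meets (f P) w \<and> meets (f Q) w}"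
  proof (intro equalityI subsetI)
    fix w assume w: "w \<in> {w\<in>code24. hamming_weight w = 9 \<and> meets (f P) w \<and> meets (f Q) w}"
    then obtain u where "u \<in> code24" "w = f u" using f(2) by blast
    with w show "w \<in> f ` {w\<in>code24. hamming_weight w = 9 \<and> meets P w \<and> meets Q w}"
      using f(1) by (auto simp: meets_isometry hamming_weight_isometry)
  qed (use f in \<open>auto simp: meets_isometry hamming_weight_isometry\<close>)
  then show ?thesis
    unfolding pair_count_def using isometry_bij [OF f(1)]
    by (metis (no_types, lifting) bij_is_inj card_image inj_on_subset subset_UNIV)
qed

lemma pair_count_axis:
  "y \<noteq> 0 \<Longrightarrow> z \<noteq> 0 \<Longrightarrow> pair_count (axis i y) (axis j z) =
     card {w\<in>code24. hamming_weight w = 9 \<and> w $ i = y \<and> w $ j = z}"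
  by (simp add: pair_count_def meets_axis)

lemma isometry_cyclic_shift: "isometry (cyclic_shift k)"
  by (simp add: isometry_def hamming_weight_cyclic_shift) (simp add: cyclic_shift_def vec_eq_iff)

lemma image_code24_eq:
  assumes "isometry f" "\<And>v. v \<in> code24 \<Longrightarrow> f v \<in> code24"
  shows "f ` code24 = code24"
  using assms isometry_bij [OF assms(1)]
  by (intro card_subset_eq) (auto simp: bij_is_inj card_image inj_on_subset [OF bij_is_inj])

lemma cyclic_shift_axis: "cyclic_shift k (axis j y) = axis (j + k) y"
  by (auto simp: cyclic_shift_def axis_def vec_eq_iff)

definition entry_count :: "24 \<Rightarrow> gf4 \<Rightarrow> nat" where
  "entry_count j y = pair_count (axis 0 GF1) (axis j y)"

lemma pair_count_shift: "pair_count (axis i GF1) (axis j y) = entry_count (j - i) y"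
proof -
  have "cyclic_shift i ` code24 = code24"
    by (simp add: image_code24_eq isometry_cyclic_shift cyclic_shift_code24)
  then show ?thesis
    using pair_count_isometry [OF isometry_cyclic_shift, of i "axis 0 GF1" "axis (j - i) y"]
    by (simp add: entry_count_def cyclic_shift_axis)
qed

subsection \<open>Words of weight 9 through two coordinates\<close>

text \<open>With \<open>b\<close>, the last odd entry, at index 23, must be 1; the shift by 1 moves
  it to index 0.\<close>

definition hits :: "bool \<Rightarrow> nat \<Rightarrow> nat \<Rightarrow> nat \<Rightarrow> gf4 list \<Rightarrow> (gf4 list \<times> gf4 list) list" where
  "hits b t i n s = filter (\<lambda>(xs, ys). list_weight ys = t \<and> (b \<longrightarrow> last ys = GF1))
     (map (\<lambda>xs. (xs, encode xs s)) (words i n))"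

fun prepend :: "gf4 \<Rightarrow> gf4 list \<times> gf4 list \<Rightarrow> gf4 list \<times> gf4 list" where
  "prepend x (xs, ys) = (x # xs, ys)"

fun shift_word :: "gf4 list \<times> gf4 list \<Rightarrow> gf4 list \<times> gf4 list" where
  "shift_word (xs, ys) = (last ys # butlast ys, xs)"

lemma evens_cyclic_shift_1: "evens (cyclic_shift 1 v) = last (odds v) # butlast (odds v)"
proof (rule nth_equalityI)
  fix k assume "k < length (evens (cyclic_shift 1 v))"
  then have k: "k < 12" by simp
  show "evens (cyclic_shift 1 v) ! k = (last (odds v) # butlast (odds v)) ! k"
  proof (cases k)
    case 0
    have "evens (cyclic_shift 1 v) ! 0 = v $ (- 1)"
      by (simp add: evens_nth cyclic_shift_def)
    also have "(- 1 :: 24) = of_nat (2 * 11 + 1)" by simp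
    also have "v $ \<dots> = odds v ! 11" by (rule odds_nth [symmetric]) simp
    also have "\<dots> = last (odds v)" by (subst last_conv_nth) (auto simp: odds_def)
    finally show ?thesis by (simp add: 0)
  next
    case (Suc m)
    then show ?thesis
      using k by (simp add: evens_nth nth_butlast odds_nth cyclic_shift_def algebra_simps)
  qed
qed simp

lemma nth_0_eq_hd_evens: "v $ 0 = hd (evens v)"
  using evens_nth [of 0 v] by (simp add: hd_conv_nth evens_def)

text \<open>The entry 1 at index 0 is the first one encoded, which leaves words of length 11 and the
  state after one step.\<close>

lemma card_words_even:
  "card {w\<in>code24. list_weight (evens w) = Suc i \<and> list_weight (odds w) = t \<and> w $ 0 = GF1 \<and> P (evens w) (odds w)} =
     length (filter (\<lambda>(xs, ys). P xs ys) (map (prepend GF1) (hits False t i 11 (encode_step GF1 zeros))))"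
proof -
  have words: "words (Suc i) 12 = words (Suc i) (Suc 11)" by simp
  have "filter (\<lambda>xs. list_weight (encode xs zeros) = t \<and> hd xs = GF1 \<and> P xs (encode xs zeros)) (words (Suc i) 12) =
     map ((#) GF1) (filter (\<lambda>xs. list_weight (encode xs (encode_step GF1 zeros)) = t \<and>
       P (GF1 # xs) (encode xs (encode_step GF1 zeros))) (words i 11))"
    unfolding words words.simps by (simp add: filter_map comp_def gf4_nonzero [symmetric])
  then show ?thesis
    using card_code24_words [of "Suc i" "\<lambda>xs ys. list_weight ys = t \<and> hd xs = GF1 \<and> P xs ys"]
    by (simp add: nth_0_eq_hd_evens hits_def filter_map comp_def split_beta conj_commute)
qed

lemma cyclic_shift_code24_iff: "cyclic_shift k v \<in> code24 \<longleftrightarrow> v \<in> code24"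
proof
  assume "cyclic_shift k v \<in> code24"
  then have "cyclic_shift (- k) (cyclic_shift k v) \<in> code24" by (rule cyclic_shift_code24)
  then show "v \<in> code24" by (simp add: cyclic_shift_cyclic_shift)
qed (rule cyclic_shift_code24)

text \<open>The enumeration runs over even halves, so words with a light odd half are obtained as
  shifts by 1 of words with a light even half.\<close>

lemma card_words_odd:
  "card {w\<in>code24. list_weight (evens w) = t \<and> list_weight (odds w) = i \<and> w $ 0 = GF1 \<and> P (evens w) (odds w)} =
     length (filter (\<lambda>(xs, ys). P xs ys) (map shift_word (hits True t i 12 zeros)))"
proof -
  let ?A = "{w\<in>code24. list_weight (evens w) = t \<and> list_weight (odds w) = i \<and> w $ 0 = GF1 \<and> P (evens w) (odds w)}"
  let ?B = "{u\<in>code24. list_weight (evens u) = i \<and> list_weight (odds u) = t \<and> last (odds u) = GF1 \<and>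
    P (last (odds u) # butlast (odds u)) (evens u)}"
  have "cyclic_shift 1 u \<in> ?A \<longleftrightarrow> u \<in> ?B" for u
    unfolding mem_Collect_eq list_weight_cyclic_shift_1 cyclic_shift_code24_iff nth_0_eq_hd_evens
    unfolding evens_cyclic_shift_1 odds_cyclic_shift_1 list.sel
    by (rule iffI; elim conjE; intro conjI; assumption)
  moreover have "w = cyclic_shift 1 (cyclic_shift (- 1) w)" for w :: "gf4 ^ 24"
    by (simp add: cyclic_shift_cyclic_shift)
  ultimately have "?A = cyclic_shift 1 ` ?B"
    by (intro set_eqI) (metis (no_types, lifting) image_iff)
  then have "card ?A = card ?B"
    by (simp add: card_image inj_on_subset [OF inj_cyclic_shift])
  then show ?thesis
    using card_code24_words [of i "\<lambda>xs ys. list_weight ys = t \<and> last ys = GF1 \<and>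
      P (last ys # butlast ys) xs"]
    by (simp add: hits_def filter_map comp_def split_beta conj_ac)
qed

text \<open>No word of weight 9 has fewer than two nonzero entries in one half, so each has two to four
  of them in exactly one of the halves.\<close>

definition weight_9_rows :: "(gf4 list \<times> gf4 list) list" where
  "weight_9_rows =
     map (prepend GF1) (hits False 7 1 11 (encode_step GF1 zeros)) @
     map (prepend GF1) (hits False 6 2 11 (encode_step GF1 zeros)) @
     map (prepend GF1) (hits False 5 3 11 (encode_step GF1 zeros)) @
     map shift_word (hits True 7 2 12 zeros) @
     map shift_word (hits True 6 3 12 zeros) @
     map shift_word (hits True 5 4 12 zeros)"

lemma card_weight_9_rows:
  "card {w\<in>code24. hamming_weight w = 9 \<and> w $ 0 = GF1 \<and> P (evens w) (odds w)} =
     length (filter (\<lambda>(xs, ys). P xs ys) weight_9_rows)"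
proof -
  let ?W = "{w\<in>code24. hamming_weight w = 9 \<and> w $ 0 = GF1 \<and> P (evens w) (odds w)}"
  define N where "N i = card {w\<in>code24. list_weight (evens w) = i \<and> list_weight (odds w) = 9 - i \<and>
    w $ 0 = GF1 \<and> P (evens w) (odds w)}" for i
  have "card ?W = (\<Sum>w\<in>?W. 1)" by simp
  also have "\<dots> = (\<Sum>i\<le>9. \<Sum>w | w \<in> ?W \<and> list_weight (evens w) = i. 1)"
    by (rule sum.group [symmetric]) (auto simp: hamming_weight_evens_odds)
  also have "\<dots> = (\<Sum>i\<le>9. N i)"
    unfolding N_def
    by (intro sum.cong refl) (auto simp: hamming_weight_evens_odds intro!: arg_cong [of _ _ card])
  also have "\<dots> = N 2 + N 3 + N 4 + N 7 + N 6 + N 5"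
  proof -
    have "weight_pair 0 9 = 0" "weight_pair 1 8 = 0"
      by (simp_all add: weight_pair_table pair_table_def)
    then have "weight_pair 0 9 = 0" "weight_pair 1 8 = 0" "weight_pair 8 1 = 0" "weight_pair 9 0 = 0"
      by (simp_all add: weight_pair_commute [of 9] weight_pair_commute [of 8])
    moreover have "N i \<le> weight_pair i (9 - i)" for i
      unfolding N_def weight_pair_def by (rule card_mono) auto
    from this [of 0] this [of 1] this [of 8] this [of 9]
    have "N 0 \<le> weight_pair 0 9" "N 1 \<le> weight_pair 1 8" "N 8 \<le> weight_pair 8 1" "N 9 \<le> weight_pair 9 0"
      by simp_all
    ultimately show ?thesis by (simp add: atMost_nat_numeral)
  qed
  also have "\<dots> = length (filter (\<lambda>(xs, ys). P xs ys) weight_9_rows)"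
    using card_words_even [of 1 7 P] card_words_even [of 2 6 P] card_words_even [of 3 5 P]
      card_words_odd [of 7 2 P] card_words_odd [of 6 3 P] card_words_odd [of 5 4 P]
    by (simp add: N_def weight_9_rows_def numeral_2_eq_2 [symmetric])
  finally show ?thesis .
qed

fun add_entry :: "gf4 \<Rightarrow> nat \<times> nat \<times> nat \<Rightarrow> nat \<times> nat \<times> nat" where
  "add_entry GF0 (a, b, c) = (a, b, c)"
| "add_entry GF1 (a, b, c) = (a + 1, b, c)"
| "add_entry GFw (a, b, c) = (a, b + 1, c)"
| "add_entry GFw2 (a, b, c) = (a, b, c + 1)"

fun entry :: "gf4 \<Rightarrow> nat \<times> nat \<times> nat \<Rightarrow> nat" where
  "entry GF0 (a, b, c) = 0"
| "entry GF1 (a, b, c) = a"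
| "entry GFw (a, b, c) = b"
| "entry GFw2 (a, b, c) = c"

fun add_row :: "gf4 list \<times> gf4 list \<Rightarrow> (nat \<times> nat \<times> nat) list \<times> (nat \<times> nat \<times> nat) list \<Rightarrow>
    (nat \<times> nat \<times> nat) list \<times> (nat \<times> nat \<times> nat) list" where
  "add_row (xs, ys) (ts, us) = (map2 add_entry xs ts, map2 add_entry ys us)"

text \<open>One pass over the rows tallies the entries 1, omega, omega^2 of all 24 coordinates, so
  the words are enumerated only once.\<close>

definition entry_table ::
    "(gf4 list \<times> gf4 list) list \<Rightarrow> (nat \<times> nat \<times> nat) list \<times> (nat \<times> nat \<times> nat) list" where
  "entry_table rs = foldr add_row rs (replicate 12 (0, 0, 0), replicate 12 (0, 0, 0))"

lemma entry_add_entry: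
  "y \<noteq> GF0 \<Longrightarrow> entry y (add_entry x t) = entry y t + (if x = y then 1 else 0)"
  by (cases t; cases x; cases y) simp_all

lemma entry_table_nth:
  assumes "list_all (\<lambda>(xs, ys). length xs = 12 \<and> length ys = 12) rs" "k < 12" "y \<noteq> GF0"
  shows "entry y (fst (entry_table rs) ! k) = length (filter (\<lambda>(xs, ys). xs ! k = y) rs)"
    and "entry y (snd (entry_table rs) ! k) = length (filter (\<lambda>(xs, ys). ys ! k = y) rs)"
proof -
  have "length (fst (entry_table rs)) = 12 \<and> length (snd (entry_table rs)) = 12 \<and>
    entry y (fst (entry_table rs) ! k) = length (filter (\<lambda>(xs, ys). xs ! k = y) rs) \<and>
    entry y (snd (entry_table rs) ! k) = length (filter (\<lambda>(xs, ys). ys ! k = y) rs)"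
    using assms(1)
  proof (induction rs)
    case Nil
    then show ?case using assms(2) by (cases y) (simp_all add: entry_table_def)
  next
    case (Cons r rs)
    obtain xs ys where r: "r = (xs, ys)" by fastforce
    obtain ts us where t: "entry_table rs = (ts, us)" by fastforce
    then have "entry_table (r # rs) = (map2 add_entry xs ts, map2 add_entry ys us)"
      by (simp add: entry_table_def r)
    with Cons t show ?case
      using assms(2,3) by (simp add: r entry_add_entry)
  qed
  then show "entry y (fst (entry_table rs) ! k) = length (filter (\<lambda>(xs, ys). xs ! k = y) rs)"
    and "entry y (snd (entry_table rs) ! k) = length (filter (\<lambda>(xs, ys). ys ! k = y) rs)" by blast+
qed

lemma length_weight_9_rows:
  "list_all (\<lambda>(xs, ys). length xs = 12 \<and> length ys = 12) weight_9_rows"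
  by (auto simp: weight_9_rows_def list_all_iff hits_def set_words)

lemma entry_count_table:
  assumes "k < 12" "y \<noteq> 0"
  shows "entry_count (of_nat (2 * k)) y = entry y (fst (entry_table weight_9_rows) ! k)"
    and "entry_count (of_nat (2 * k + 1)) y = entry y (snd (entry_table weight_9_rows) ! k)"
proof -
  have y: "y \<noteq> GF0" using assms(2) by (simp add: zero_gf4_def)
  have "entry_count j y = card {w\<in>code24. hamming_weight w = 9 \<and> w $ 0 = GF1 \<and> w $ j = y}" for j
    using assms(2) by (simp add: entry_count_def pair_count_axis)
  then show "entry_count (of_nat (2 * k)) y = entry y (fst (entry_table weight_9_rows) ! k)"
    and "entry_count (of_nat (2 * k + 1)) y = entry y (snd (entry_table weight_9_rows) ! k)"
    using card_weight_9_rows [of "\<lambda>xs ys. xs ! k = y"] card_weight_9_rows [of "\<lambda>xs ys. ys ! k = y"]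
      entry_table_nth [OF length_weight_9_rows assms(1) y]
    by (simp_all add: evens_nth odds_nth assms(1))
qed

section \<open>Evaluation of the entry table\<close>

fun keep_hit :: "bool \<Rightarrow> gf4 list \<times> gf4 list \<Rightarrow> (gf4 list \<times> gf4 list) list" where
  "keep_hit b (xs, ys) = (if b \<longrightarrow> last ys = GF1 then [(xs, ys)] else [])"

text \<open>With the weight test as an argument, rewriting can discard a failing word without
  completing its encoding.\<close>

definition hit_leaf :: "bool \<Rightarrow> bool \<Rightarrow> nat \<Rightarrow> gf4 list \<Rightarrow> (gf4 list \<times> gf4 list) list" where
  "hit_leaf c b n s = (if c then keep_hit b (replicate n 0, encode (replicate n 0) s) else [])"

lemma hit_leaf_simps:
  "hit_leaf True b n s = keep_hit b (replicate n GF0, encode (replicate n GF0) s)"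
  "hit_leaf False b n s = []"
  "keep_hit False p = [p]"
  "keep_hit True (xs, [a0,a1,a2,a3,a4,a5,a6,a7,a8,a9,a10,GF0]) = []"
  "keep_hit True (xs, [a0,a1,a2,a3,a4,a5,a6,a7,a8,a9,a10,GF1]) = [(xs, [a0,a1,a2,a3,a4,a5,a6,a7,a8,a9,a10,GF1])]"
  "keep_hit True (xs, [a0,a1,a2,a3,a4,a5,a6,a7,a8,a9,a10,GFw]) = []"
  "keep_hit True (xs, [a0,a1,a2,a3,a4,a5,a6,a7,a8,a9,a10,GFw2]) = []"
  by (cases p; simp add: hit_leaf_def zero_gf4_def)+

text \<open>The remaining zeros leave the weight unchanged, so it is tested at once; the surviving
  words still need the rotations that bring their entries into place.\<close>

lemma hits_0:
  "hits b t 0 n [a0,a1,a2,a3,a4,a5,a6,a7,a8,a9,a10,a11] =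
     hit_leaf (list_weight [a0,a1,a2,a3,a4,a5,a6,a7,a8,a9,a10,a11] = t) b n [a0,a1,a2,a3,a4,a5,a6,a7,a8,a9,a10,a11]"
  by (simp add: hits_def hit_leaf_def list_weight_encode_replicate_0 del: list_weight_simps)

lemma hits_Suc:
  "hits b t (Suc i) 0 s = []"
  "hits b t (Suc i) (Suc n) s =
     map (prepend GF0) (hits b t (Suc i) n (encode_step GF0 s)) @
     map (prepend GF1) (hits b t i n (encode_step GF1 s)) @
     map (prepend GFw) (hits b t i n (encode_step GFw2 s)) @
     map (prepend GFw2) (hits b t i n (encode_step GFw s))"
  by (simp_all add: hits_def filter_map comp_def split_beta zero_gf4_def)

lemma encode_rules:
  "encode [] s = s" "encode (GF0 # xs) s = encode xs (encode_step GF0 s)"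
  by simp_all

lemma shift_word_rule:
  "shift_word (xs, [a0,a1,a2,a3,a4,a5,a6,a7,a8,a9,a10,a11]) = ([a11,a0,a1,a2,a3,a4,a5,a6,a7,a8,a9,a10], xs)"
  by simp

lemma entry_table_rules:
  "entry_table [] = ([(0, 0, 0), (0, 0, 0), (0, 0, 0), (0, 0, 0), (0, 0, 0), (0, 0, 0), (0, 0, 0), (0, 0, 0), (0, 0, 0), (0, 0, 0), (0, 0, 0), (0, 0, 0)], [(0, 0, 0), (0, 0, 0), (0, 0, 0), (0, 0, 0), (0, 0, 0), (0, 0, 0), (0, 0, 0), (0, 0, 0), (0, 0, 0), (0, 0, 0), (0, 0, 0), (0, 0, 0)])"
  "entry_table (r # rs) = add_row r (entry_table rs)"
  "map2 add_entry [] [] = []"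
  "map2 add_entry (x # xs) (t # ts) = add_entry x t # map2 add_entry xs ts"
  by (simp_all add: entry_table_def numeral_eq_Suc)

lemma weight_9_rows_unary:
  "weight_9_rows =
     map (prepend GF1) (hits False (Suc (Suc (Suc (Suc (Suc (Suc (Suc 0))))))) (Suc 0) (Suc (Suc (Suc (Suc (Suc (Suc (Suc (Suc (Suc (Suc (Suc 0))))))))))) (encode_step GF1 zeros)) @
     map (prepend GF1) (hits False (Suc (Suc (Suc (Suc (Suc (Suc 0)))))) (Suc (Suc 0)) (Suc (Suc (Suc (Suc (Suc (Suc (Suc (Suc (Suc (Suc (Suc 0))))))))))) (encode_step GF1 zeros)) @
     map (prepend GF1) (hits False (Suc (Suc (Suc (Suc (Suc 0))))) (Suc (Suc (Suc 0))) (Suc (Suc (Suc (Suc (Suc (Suc (Suc (Suc (Suc (Suc (Suc 0))))))))))) (encode_step GF1 zeros)) @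
     map shift_word (hits True (Suc (Suc (Suc (Suc (Suc (Suc (Suc 0))))))) (Suc (Suc 0)) twelve zeros) @
     map shift_word (hits True (Suc (Suc (Suc (Suc (Suc (Suc 0)))))) (Suc (Suc (Suc 0))) twelve zeros) @
     map shift_word (hits True (Suc (Suc (Suc (Suc (Suc 0))))) (Suc (Suc (Suc (Suc 0)))) twelve zeros)"
  by (simp add: weight_9_rows_def numeral_eq_Suc)

lemmas hits_eval = hits_0 hits_Suc hit_leaf_simps encode_rules encode_step_rules list_weight_rules zeros_eval
  gf4_add_table nat.inject nat.distinct simp_thms(6) replicate.simps list.map append.simps prepend.simps shift_word_rule

lemmas entry_table_eval = entry_table_rules add_row.simps add_entry.simps
  add_0_left one_add_one numeral_plus_one add_num_simps

text \<open>The first triple has 219 = 1752 * 9 / 72, as transitivity on the 72 vectors of weight 1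
  demands.\<close>

lemma entry_table_weight_9_rows:
  "entry_table weight_9_rows = ([(219, 0, 0), (20, 29, 26), (28, 25, 19), (22, 29, 23), (28, 28, 22), (25, 26, 25), (24, 31, 31), (25, 25, 26), (28, 22, 28), (22, 23, 29), (28, 19, 25), (20, 26, 29)],
     [(34, 27, 21), (28, 23, 25), (25, 24, 28), (18, 25, 24), (24, 25, 29), (25, 28, 25), (25, 28, 25), (24, 25, 29), (18, 25, 24), (25, 24, 28), (28, 23, 25), (34, 27, 21)])"
  unfolding weight_9_rows_unary
  by (simp only: hits_eval entry_table_eval)

subsection \<open>The automorphism group\<close>

definition entry_matrix :: "nat \<Rightarrow> nat \<times> nat \<times> nat" where
  "entry_matrix n = (if even n then fst (entry_table weight_9_rows) else snd (entry_table weight_9_rows)) ! (n div 2)"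

lemma entry_count_of_nat:
  assumes "n < 24" "y \<noteq> 0"
  shows "entry_count (of_nat n) y = entry y (entry_matrix n)"
proof (cases "even n")
  case True
  then obtain k where "n = 2 * k" by auto
  then show ?thesis using entry_count_table(1) [of k y] assms by (simp add: entry_matrix_def)
next
  case False
  then obtain k where "n = 2 * k + 1" by (auto elim: oddE)
  then show ?thesis using entry_count_table(2) [of k y] assms by (simp add: entry_matrix_def)
qed

lemma entry_count_values:
  "entry_count 1 GF1 = 34" "entry_count 1 GFw = 27" "entry_count 1 GFw2 = 21"
  "entry_count (- 1) GF1 = 34" "entry_count (- 1) GFw = 27" "entry_count (- 1) GFw2 = 21"
  "entry_count 2 GFw = 29" "entry_count (- 2) GFw = 26"
proof -
  have "(- 1 :: 24) = of_nat 23" "(- 2 :: 24) = of_nat 22" by simp_all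
  then show "entry_count 1 GF1 = 34" "entry_count 1 GFw = 27" "entry_count 1 GFw2 = 21"
    "entry_count (- 1) GF1 = 34" "entry_count (- 1) GFw = 27" "entry_count (- 1) GFw2 = 21"
    "entry_count 2 GFw = 29" "entry_count (- 2) GFw = 26"
    using entry_count_of_nat [of 1] entry_count_of_nat [of 2] entry_count_of_nat [of 22] entry_count_of_nat [of 23]
    by (simp_all only: gf4_nonzero not_False_eq_True) (simp_all add: entry_matrix_def entry_table_weight_9_rows)
qed

lemma entry_count_eq_34:
  assumes "entry_count j y = 34" "y \<noteq> 0"
  shows "y = GF1 \<and> (j = 1 \<or> j = - 1)"
proof -
  obtain n where n: "n < 24" "j = of_nat n" using ex_of_nat_24 by blast
  have all: "\<forall>n<24. entry GF1 (entry_matrix n) = 34 \<longrightarrow> n = 1 \<or> n = 23"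
    "\<forall>n<24. entry GFw (entry_matrix n) \<noteq> 34" "\<forall>n<24. entry GFw2 (entry_matrix n) \<noteq> 34"
    unfolding all_less_24 by (simp_all add: entry_matrix_def entry_table_weight_9_rows)
  have "entry y (entry_matrix n) = 34"
    using entry_count_of_nat [OF n(1) assms(2)] assms(1) n(2) by simp
  with all n(1) assms(2) have "y = GF1 \<and> (n = 1 \<or> n = 23)"
    by (cases y) (auto simp: zero_gf4_def)
  moreover have "(of_nat 23 :: 24) = - 1" by simp
  ultimately show ?thesis using n(2) by auto
qed

lemma axis_eq_iff: "y \<noteq> 0 \<Longrightarrow> axis i y = axis j z \<longleftrightarrow> i = j \<and> y = z"
  by (auto simp: axis_def vec_eq_iff split: if_splits)

lemma step_eq:
  fixes j k e :: "'a::ring_1"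
  assumes "j - k = 1 \<or> j - k = - 1" "e = 1 \<or> e = - 1"
  shows "j = k + e \<or> j = k - e"
  using assms by (auto simp: diff_eq_eq)

text \<open>The pairs of coordinates whose count is 34 form a cycle, which an automorphism fixing
  \<open>axis 0 1\<close> can only fix or reverse; the other counts exclude the reversal and a nontrivial action on
  a coordinate.\<close>

lemma automorphism_fixing_axis:
  assumes f: "isometry f" "f ` code24 = code24" and fix0: "f (axis 0 GF1) = axis 0 GF1"
  shows "f v = v"
proof -
  note count = pair_count_isometry [OF f]
  have count0: "entry_count k z = entry_count j y" if "f (axis j y) = axis k z" for j k y z
    using count [of "axis 0 GF1" "axis j y"] by (simp add: entry_count_def fix0 that)
  obtain e z where e: "z \<noteq> 0" "f (axis 1 GF1) = axis e z"
    by (rule isometry_axis [OF f(1) gf4_nonzero(1)])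
  with count0 [of 1 GF1 e z] have e1: "z = GF1" "e = 1 \<or> e = - 1"
    using entry_count_eq_34 [of e z] by (auto simp: entry_count_values)
  \<comment> \<open>Two consecutive indices are carried along: the image of the next one is a
    neighbour of the image of the second, and injectivity forbids a return to the image of the
    first.\<close>
  have nat: "f (axis (of_nat n) GF1) = axis (of_nat n * e) GF1 \<and>
      f (axis (of_nat (Suc n)) GF1) = axis (of_nat (Suc n) * e) GF1" for n
  proof (induction n)
    case 0
    then show ?case using e e1 fix0 by simp
  next
    case (Suc n)
    let ?k = "of_nat (Suc n) :: 24"
    obtain j y where j: "y \<noteq> 0" "f (axis (?k + 1) GF1) = axis j y"
      by (rule isometry_axis [OF f(1) gf4_nonzero(1)])
    have "entry_count (j - ?k * e) y = 34"
      using count [of "axis ?k GF1" "axis (?k + 1) GF1"] Suc j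
      by (simp only: pair_count_shift add_diff_cancel_left' entry_count_values)
    then have y: "y = GF1" and step: "j - ?k * e = 1 \<or> j - ?k * e = - 1"
      using entry_count_eq_34 j(1) by blast+
    from step e1(2) have "j = ?k * e + e \<or> j = ?k * e - e" by (rule step_eq)
    moreover have "j \<noteq> ?k * e - e"
    proof
      assume "j = ?k * e - e"
      then have "f (axis (?k + 1) GF1) = f (axis (of_nat n) GF1)"
        using Suc j y by (simp add: algebra_simps)
      then have "axis (?k + 1) GF1 = axis (of_nat n) GF1"
        using isometry_bij [OF f(1)] by (simp add: bij_is_inj inj_eq)
      then have "(of_nat n :: 24) + 2 = of_nat n" by (simp add: axis_eq_iff algebra_simps)
      then show False by simp
    qed
    ultimately have "f (axis (of_nat (Suc (Suc n))) GF1) = axis (of_nat (Suc (Suc n)) * e) GF1"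
      using j(2) y by (simp add: algebra_simps)
    then show ?case using Suc by blast
  qed
  have f1: "f (axis j GF1) = axis (j * e) GF1" for j
    using nat ex_of_nat_24 [of j] by blast
  have fw: "f (axis j GFw) = axis (j * e) GFw" for j
  proof -
    obtain k z where k: "z \<noteq> 0" "f (axis j GFw) = axis k z"
      by (rule isometry_axis [OF f(1) gf4_nonzero(2)])
    \<comment> \<open>Since 1 + omega = omega^2, the vectors for 1 and omega at j add up to weight
      1, and so do their images; this forces the images into one coordinate.\<close>
    have sum: "axis j GFw2 = axis j GF1 + (axis j GFw :: gf4 ^ 24)"
      by (simp add: axis_add [symmetric])
    have w1: "hamming_weight (axis (j * e) GF1 + axis k z) = 1"
      using hamming_weight_isometry [OF f(1), of "axis j GFw2"]
      by (simp add: sum isometry_add [OF f(1)] f1 k(2)) (simp add: sum [symmetric] hamming_weight_axis)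
    have k_eq: "k = j * e"
    proof (rule ccontr)
      assume ne: "k \<noteq> j * e"
      have "{i. (axis (j * e) GF1 + axis k z) $ i \<noteq> 0} = {j * e, k}"
        using ne k(1) by (auto simp: axis_def)
      with w1 ne show False by (simp add: hamming_weight_def)
    qed
    moreover have "z \<noteq> GF1"
      using w1 k_eq by (auto simp: hamming_weight_def)
    moreover have "z \<noteq> GFw2"
    proof
      assume z: "z = GFw2"
      \<comment> \<open>The count 27 for the pair \<open>axis (j - 1) GF1\<close>,
        \<open>axis j GFw\<close> would become 21, for either sign of e.\<close>
      have "entry_count e z = entry_count 1 GFw"
        using count [of "axis (j - 1) GF1" "axis j GFw"] k(2) k_eq
        by (simp add: f1 pair_count_shift algebra_simps)
      with z e1(2) show False by (auto simp: entry_count_values)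
    qed
    ultimately show ?thesis using k by (cases z) (auto simp: zero_gf4_def)
  qed
  \<comment> \<open>The reversal would send \<open>axis 2 GFw\<close> to
    \<open>axis (- 2) GFw\<close>, but their counts with \<open>axis 0 GF1\<close> are 29 and
    26.\<close>
  have "e = 1"
    using e1(2) count0 [OF fw [of 2]] by (auto simp: entry_count_values)
  moreover have "f (axis j GFw2) = axis (j * e) GFw2" for j
    using isometry_add [OF f(1), of "axis j GF1" "axis j GFw"]
    by (simp add: f1 fw axis_add [symmetric])
  ultimately have "f (axis j y) = axis j y" if "y \<noteq> 0" for j y
    using that f1 fw by (cases y) (auto simp: zero_gf4_def)
  then show ?thesis by (rule isometry_eqI [OF f(1)])
qed

text \<open>In the residues modulo 24, \<open>12 * i = 0\<close> says that \<open>i\<close> is even.\<close>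

definition twist :: "gf4 \<Rightarrow> 24 \<Rightarrow> gf4" where
  "twist c i = (if 12 * i = 0 then c else conj_gf4 c)"

definition twisted_shift :: "24 \<Rightarrow> gf4 \<Rightarrow> gf4 ^ 24 \<Rightarrow> gf4 ^ 24" where
  "twisted_shift k c = coord_map (\<lambda>i. i - k) (twist c) {}"

lemma twisted_shift_nth: "twisted_shift k c v $ i = twist c i * cyclic_shift k v $ i"
  by (simp add: twisted_shift_def coord_map_def cyclic_shift_def)

lemma twist_of_nat: "twist c (of_nat (2 * k)) = c" "twist c (of_nat (2 * k + 1)) = conj_gf4 c"
proof -
  have eq: "12 * (of_nat n :: 24) = 0 \<longleftrightarrow> 12 * n mod 24 = 0" for n
    using of_nat_24_eq_iff [of "12 * n" 0] by simp
  have "12 * (2 * k) mod 24 = 0" "12 * (2 * k + 1) mod 24 \<noteq> 0" by presburger+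
  then show "twist c (of_nat (2 * k)) = c" "twist c (of_nat (2 * k + 1)) = conj_gf4 c"
    unfolding twist_def eq by simp_all
qed

text \<open>The encoding is conjugate-linear in the word; this is why \<open>twist\<close>
  conjugates the scalar on the odd coordinates.\<close>

lemma encode_scale:
  "length s = 12 \<Longrightarrow> encode (map ((*) c) xs) (map ((*) (conj_gf4 c)) s) = map ((*) (conj_gf4 c)) (encode xs s)"
  by (induction xs arbitrary: s) (simp_all add: conj_gf4_mult encode_step_scale)

lemma twisted_shift_code24:
  assumes "v \<in> code24"
  shows "twisted_shift k c v \<in> code24"
proof -
  let ?u = "cyclic_shift k v"
  have u: "odds ?u = encode (evens ?u) zeros"
    using cyclic_shift_code24 [OF assms] by (simp add: code24_iff)
  have "evens (twisted_shift k c v) = map ((*) c) (evens ?u)"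
    unfolding evens_def by (simp only: twisted_shift_nth twist_of_nat list.map_comp comp_def)
  moreover have "odds (twisted_shift k c v) = map ((*) (conj_gf4 c)) (odds ?u)"
    unfolding odds_def by (simp only: twisted_shift_nth twist_of_nat list.map_comp comp_def)
  ultimately show ?thesis
    using encode_scale [of zeros c "evens ?u"] by (simp add: code24_iff u)
qed

lemma twist_nonzero: "c \<noteq> 0 \<Longrightarrow> twist c i \<noteq> 0"
  by (simp add: twist_def)

lemma twisted_shift_automorphism:
  assumes "c \<noteq> 0"
  shows "twisted_shift k c \<in> automorphism_group code24"
proof -
  have "bij (\<lambda>i :: 24. i - k)"
    by (rule bij_betw_byWitness [where f' = "\<lambda>i. i + k"]) auto
  then have "twisted_shift k c \<in> equivalence_maps"
    unfolding equivalence_maps_def twisted_shift_def using twist_nonzero [OF assms] by blast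
  then show ?thesis
    by (simp add: automorphism_group_def image_code24_eq isometry_equivalence twisted_shift_code24)
qed

lemma twisted_shift_axis: "twisted_shift k c (axis 0 GF1) = axis k (twist c k)"
proof -
  have "GF1 = 1" by (simp add: one_gf4_def)
  then show ?thesis
    by (auto simp: vec_eq_iff twisted_shift_nth cyclic_shift_axis) (simp_all add: axis_def)
qed

section \<open>Orbit and stabilizer of a vector of weight 1\<close>

lemma card_axes: "card {axis j y | (j :: 24) y. y \<noteq> (0 :: gf4)} = 72"
proof -
  have "{axis j y | (j :: 24) y. y \<noteq> (0 :: gf4)} = (\<lambda>(j, y). axis j y) ` (UNIV \<times> (UNIV - {0}))"
    by auto
  moreover have "inj_on (\<lambda>(j, y). axis j y) ((UNIV :: 24 set) \<times> (UNIV - {0 :: gf4}))"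
    by (rule inj_onI) (auto simp: axis_eq_iff)
  ultimately show ?thesis
    by (simp add: card_image card_cartesian_product gf4_elements(2))
qed

lemma automorphism_isometry: "f \<in> automorphism_group code24 \<Longrightarrow> isometry f"
  by (simp add: automorphism_group_def isometry_equivalence)

text \<open>The stabilizer result applies to the inverse of g composed with f.\<close>

lemma automorphism_eqI:
  assumes f: "f \<in> automorphism_group code24" and g: "g \<in> automorphism_group code24"
    and eq: "f (axis 0 GF1) = g (axis 0 GF1)"
  shows "f = g"
proof
  fix v
  have inj: "inj g" and surj: "surj g"
    using isometry_bij [OF automorphism_isometry [OF g]] by (simp_all add: bij_def)
  have iso: "isometry (inv g \<circ> f)"
    using f g by (simp add: isometry_compose isometry_inv automorphism_isometry)
  have code: "f ` code24 = code24" "g ` code24 = code24"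
    using f g by (simp_all add: automorphism_group_def)
  have "(inv g \<circ> f) ` code24 = inv g ` (f ` code24)" by (rule image_comp [symmetric])
  also have "\<dots> = inv g ` (g ` code24)" by (simp only: code)
  also have "\<dots> = code24" by (rule image_inv_f_f [OF inj])
  finally have image: "(inv g \<circ> f) ` code24 = code24" .
  have "(inv g \<circ> f) (axis 0 GF1) = axis 0 GF1" by (simp add: eq inj)
  then have "(inv g \<circ> f) v = v" by (rule automorphism_fixing_axis [OF iso image])
  then show "f v = g v" using surj by (metis comp_apply surj_f_inv_f)
qed

lemma card_automorphism_group_code24: "card (automorphism_group code24) = 72"
proof -
  have "inj_on (\<lambda>f. f (axis 0 GF1)) (automorphism_group code24)"
    by (rule inj_onI) (rule automorphism_eqI)
  moreover have "(\<lambda>f. f (axis 0 GF1)) ` automorphism_group code24 = {axis j y | j y. y \<noteq> 0}"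
  proof (intro equalityI subsetI)
    fix P assume "P \<in> (\<lambda>f. f (axis 0 GF1)) ` automorphism_group code24"
    then obtain f where f: "isometry f" "P = f (axis 0 GF1)" using automorphism_isometry by blast
    obtain k z where "z \<noteq> 0" "f (axis 0 GF1) = axis k z"
      by (rule isometry_axis [OF f(1) gf4_nonzero(1)])
    with f(2) show "P \<in> {axis j y | j y. y \<noteq> 0}" by blast
  next
    fix P :: "gf4 ^ 24" assume "P \<in> {axis j y | j y. y \<noteq> 0}"
    then obtain j y where P: "y \<noteq> 0" "P = axis j y" by blast
    \<comment> \<open>In its scalar, \<open>twist\<close> is an involution at each coordinate, so
      the scalar \<open>twist y j\<close> produces the entry y.\<close>
    have "twist (twist y j) j = y" by (simp add: twist_def)
    then have "P = twisted_shift j (twist y j) (axis 0 GF1)"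
      by (simp add: P twisted_shift_axis)
    then show "P \<in> (\<lambda>f. f (axis 0 GF1)) ` automorphism_group code24"
      using twisted_shift_automorphism [OF twist_nonzero [OF P(1)]] by blast
  qed
  ultimately show ?thesis
    using card_image [of "\<lambda>f. f (axis 0 GF1)" "automorphism_group code24"] by (simp add: card_axes)
qed

theorem mainTheorem6:
  shows "additive_code 24 24 9 code24 \<and>
    isodual code24 \<and>
    card (automorphism_group code24) = 72 \<and>
    (let y = [:0, 1:] :: int poly in
      weight_enumerator code24 1 y =
        1 + 1752 * y^9 + 8748 * y^10 + 26064 * y^11 + 81408 * y^12 + 232776 * y^13
        + 573516 * y^14 + 1119264 * y^15 + 1869777 * y^16 + 2676456 * y^17
        + 3096804 * y^18 + 2959056 * y^19 + 2204568 * y^20 + 1255416 * y^21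
        + 520740 * y^22 + 134208 * y^23 + 16662 * y^24)"
  unfolding Let_def
  by (intro conjI additive_code_code24 isodual_code24 card_automorphism_group_code24 weight_enumerator_code24)

end
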